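(* Let $\mathrm{St}_3(\mathbb Z)$ be the Steinberg group \[ \langle x_{ij}\ (i,j\in\{1,2,3\},\ i\ne j)\mid [x_{ij},x_{jk}]=x_{ik}\ (i\neq k),\ [x_{ij},x_{kl}]=1\ (i\ne l,\ j\ne k)\rangle . \] Then its Kazhdan constant satisfies \[ 0.171028\le \kappa(\mathrm{St}_3(\mathbb Z),\{x_{ij}\}). \]
   Context: For a group $\Gamma$ with finite generating set $S$ and a unitary representation $\pi$ of $\Gamma$ on a Hilbert space $\mathcal H$, put $\kappa(\Gamma,S,\pi)=\inf_{\xi\in\mathcal H,\ \|\xi\|=1}\ \max_{s\in S}\|\pi(s)\xi-\xi\|$. The (optimal) Kazhdan constant is $\kappa(\Gamma,S)=\inf\{\kappa(\Gamma,S,\pi)\mid \pi \text{ has no non-zero invariant vector}\}$. The bracket $[x,y]$ denotes the commutator of $x$ and $y$. *)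

theory Defs
  imports "HOL-Algebra.Group_Action" "HOL-Algebra.Module" "HOL-Library.Extended_Real" Complex_Main
begin

section \<open>Groups given by generators and relations\<close>

text \<open>The letter \<open>(x, True)\<close> stands for the generator \<open>x\<close> and \<open>(x, False)\<close> for its formal inverse.
  A relation is a pair of words that become equal in the group.\<close>

type_synonym 'x word = "('x \<times> bool) list"

definition words :: "'x set \<Rightarrow> 'x word set"
  where "words X = lists (X \<times> UNIV)"

inductive_set word_eq :: "'x set \<Rightarrow> ('x word \<times> 'x word) set \<Rightarrow> ('x word \<times> 'x word) set"
  for X :: "'x set" and R :: "('x word \<times> 'x word) set"
where
  cancel: "\<lbrakk>u \<in> words X; v \<in> words X; x \<in> X\<rbrakk> \<Longrightarrow> (u @ [(x, b), (x, \<not> b)] @ v, u @ v) \<in> word_eq X R"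
| relation: "\<lbrakk>u \<in> words X; v \<in> words X; (l, r) \<in> R; l \<in> words X; r \<in> words X\<rbrakk>
    \<Longrightarrow> (u @ l @ v, u @ r @ v) \<in> word_eq X R"
| refl: "w \<in> words X \<Longrightarrow> (w, w) \<in> word_eq X R"
| sym: "(u, v) \<in> word_eq X R \<Longrightarrow> (v, u) \<in> word_eq X R"
| trans: "\<lbrakk>(u, v) \<in> word_eq X R; (v, w) \<in> word_eq X R\<rbrakk> \<Longrightarrow> (u, w) \<in> word_eq X R"

definition presented_group :: "'x set \<Rightarrow> ('x word \<times> 'x word) set \<Rightarrow> 'x word set monoid"
  where "presented_group X R =
    \<lparr>carrier = words X // word_eq X R,
     mult = (\<lambda>A B. \<Union>u\<in>A. \<Union>v\<in>B. word_eq X R `` {u @ v}),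
     one = word_eq X R `` {[]}\<rparr>"

definition presented_gen :: "'x set \<Rightarrow> ('x word \<times> 'x word) set \<Rightarrow> 'x \<Rightarrow> 'x word set"
  where "presented_gen X R x = word_eq X R `` {[(x, True)]}"

lemma words_simps [simp]:
  "[] \<in> words X" "u @ v \<in> words X \<longleftrightarrow> u \<in> words X \<and> v \<in> words X"
  "(x, b) # w \<in> words X \<longleftrightarrow> x \<in> X \<and> w \<in> words X"
  by (auto simp: words_def)

lemma word_eq_words: "(u, v) \<in> word_eq X R \<Longrightarrow> u \<in> words X \<and> v \<in> words X"
  by (induction rule: word_eq.induct) auto

lemma equiv_word_eq: "equiv (words X) (word_eq X R)"
proof (rule equivI)
  show "word_eq X R \<subseteq> words X \<times> words X" by (auto dest: word_eq_words)
  show "refl_on (words X) (word_eq X R)" by (rule refl_onI) (rule word_eq.refl)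
  show "sym_on UNIV (word_eq X R)" by (rule symI) (rule word_eq.sym)
  show "trans_on UNIV (word_eq X R)" by (rule transI) (rule word_eq.trans)
qed

lemma word_eq_context:
  assumes "(u, v) \<in> word_eq X R" "a \<in> words X" "c \<in> words X"
  shows "(a @ u @ c, a @ v @ c) \<in> word_eq X R"
  using assms
proof (induction rule: word_eq.induct)
  case (cancel u v x b)
  then show ?case using word_eq.cancel[of "a @ u" X "v @ c" x b R] by simp
next
  case (relation u v l r)
  then show ?case using word_eq.relation[of "a @ u" X "v @ c" l r R] by simp
next
  case (refl w)
  then show ?case by (intro word_eq.refl) simp
next
  case (sym u v)
  then show ?case by (blast intro: word_eq.sym)
next
  case (trans u v w)
  then show ?case by (blast intro: word_eq.trans)
qed

lemma word_eq_append:
  assumes "(u, u') \<in> word_eq X R" "(v, v') \<in> word_eq X R"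
  shows "(u @ v, u' @ v') \<in> word_eq X R"
proof (rule word_eq.trans)
  show "(u @ v, u' @ v) \<in> word_eq X R"
    using word_eq_context[OF assms(1), of "[]" v] word_eq_words[OF assms(2)] by simp
  show "(u' @ v, u' @ v') \<in> word_eq X R"
    using word_eq_context[OF assms(2), of u' "[]"] word_eq_words[OF assms(1)] by simp
qed

lemma word_class_eq_iff:
  "\<lbrakk>u \<in> words X; v \<in> words X\<rbrakk>
    \<Longrightarrow> word_eq X R `` {u} = word_eq X R `` {v} \<longleftrightarrow> (u, v) \<in> word_eq X R"
  by (rule eq_equiv_class_iff[OF equiv_word_eq])

lemma presented_group_mult_class:
  assumes "u \<in> words X" "v \<in> words X"
  shows "(word_eq X R `` {u}) \<otimes>\<^bsub>presented_group X R\<^esub> (word_eq X R `` {v}) = word_eq X R `` {u @ v}"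
    (is "?A \<otimes>\<^bsub>_\<^esub> ?B = ?C")
proof -
  have eq: "word_eq X R `` {u' @ v'} = ?C" if "u' \<in> ?A" "v' \<in> ?B" for u' v'
  proof (rule equiv_class_eq[OF equiv_word_eq, symmetric])
    show "(u @ v, u' @ v') \<in> word_eq X R" using that by (intro word_eq_append) simp_all
  qed
  have "u \<in> ?A" "v \<in> ?B" using assms by (simp_all add: word_eq.refl)
  then have "?A \<noteq> {}" "?B \<noteq> {}" by blast+
  have "?A \<otimes>\<^bsub>presented_group X R\<^esub> ?B = (\<Union>u'\<in>?A. \<Union>v'\<in>?B. word_eq X R `` {u' @ v'})"
    by (simp only: presented_group_def monoid.simps)
  also have "\<dots> = (\<Union>u'\<in>?A. \<Union>v'\<in>?B. ?C)"
    by (intro SUP_cong eq HOL.refl)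
  also have "\<dots> = ?C"
    using \<open>?A \<noteq> {}\<close> \<open>?B \<noteq> {}\<close> by (simp only: UN_constant if_False)
  finally show ?thesis .
qed

lemma word_inverse:
  assumes "w \<in> words X"
  shows "\<exists>w'\<in>words X. (w' @ w, []) \<in> word_eq X R"
  using assms
proof (induction w)
  case Nil
  then show ?case by (intro bexI[of _ "[]"]) (auto intro: word_eq.refl)
next
  case (Cons p w)
  obtain x b where p: "p = (x, b)" by fastforce
  with Cons obtain w' where w': "w' \<in> words X" "(w' @ w, []) \<in> word_eq X R" by auto
  have "((w' @ [(x, \<not> b)]) @ p # w, w' @ w) \<in> word_eq X R"
    using word_eq.cancel[of w' X w x "\<not> b" R] Cons.prems w'(1) p by simp
  then have "((w' @ [(x, \<not> b)]) @ p # w, []) \<in> word_eq X R" using w'(2) by (rule word_eq.trans)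
  moreover have "w' @ [(x, \<not> b)] \<in> words X" using Cons.prems w'(1) p by simp
  ultimately show ?case by blast
qed

lemma group_presented_group: "group (presented_group X R)"
proof (rule groupI)
  let ?G = "presented_group X R" and ?c = "\<lambda>w. word_eq X R `` {w}"
  have car: "A \<in> carrier ?G \<longleftrightarrow> (\<exists>w\<in>words X. A = ?c w)" for A
    by (auto simp: presented_group_def quotient_def)
  have one: "\<one>\<^bsub>?G\<^esub> = ?c []" by (simp add: presented_group_def)
  note mult = presented_group_mult_class[of _ X _ R]
  show "\<one>\<^bsub>?G\<^esub> \<in> carrier ?G" unfolding car one by (intro bexI[of _ "[]"]) auto
  show "A \<otimes>\<^bsub>?G\<^esub> B \<in> carrier ?G" if "A \<in> carrier ?G" "B \<in> carrier ?G" for A B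
  proof -
    from that obtain u v where "u \<in> words X" "A = ?c u" "v \<in> words X" "B = ?c v"
      unfolding car by blast
    then show ?thesis unfolding car by (intro bexI[of _ "u @ v"]) (auto simp: mult)
  qed
  show "A \<otimes>\<^bsub>?G\<^esub> B \<otimes>\<^bsub>?G\<^esub> C = A \<otimes>\<^bsub>?G\<^esub> (B \<otimes>\<^bsub>?G\<^esub> C)"
    if "A \<in> carrier ?G" "B \<in> carrier ?G" "C \<in> carrier ?G" for A B C
  proof -
    from that obtain u v w where "u \<in> words X" "A = ?c u" "v \<in> words X" "B = ?c v"
      "w \<in> words X" "C = ?c w"
      unfolding car by blast
    then show ?thesis by (simp add: mult)
  qed
  show "\<one>\<^bsub>?G\<^esub> \<otimes>\<^bsub>?G\<^esub> A = A" if "A \<in> carrier ?G" for A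
    using that by (auto simp: car one mult)
  show "\<exists>B\<in>carrier ?G. B \<otimes>\<^bsub>?G\<^esub> A = \<one>\<^bsub>?G\<^esub>" if "A \<in> carrier ?G" for A
  proof -
    from that obtain w where w: "w \<in> words X" "A = ?c w" unfolding car by blast
    from word_inverse[OF w(1)] obtain w' where w': "w' \<in> words X" "(w' @ w, []) \<in> word_eq X R"
      by blast
    have "?c w' \<otimes>\<^bsub>?G\<^esub> A = \<one>\<^bsub>?G\<^esub>"
      using w w' by (simp add: mult one word_class_eq_iff)
    then show ?thesis using w'(1) by (intro bexI[of _ "?c w'"]) (auto simp: car)
  qed
qed

section \<open>The Steinberg group\<close>

text \<open>The pair \<open>(i, j)\<close> names the generator \<open>x_ij\<close>, and \<open>[x, y]\<close> is \<open>x y x\<^sup>-\<^sup>1 y\<^sup>-\<^sup>1\<close>.\<close>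

definition commutator_word :: "'x \<Rightarrow> 'x \<Rightarrow> 'x word"
  where "commutator_word x y = [(x, True), (y, True), (x, False), (y, False)]"

definition St3_indices :: "(nat \<times> nat) set"
  where "St3_indices = {(i, j). i \<in> {1, 2, 3} \<and> j \<in> {1, 2, 3} \<and> i \<noteq> j}"

definition St3_relations :: "((nat \<times> nat) word \<times> (nat \<times> nat) word) set"
  where "St3_relations =
    {(commutator_word (i, j) (j, k), [((i, k), True)]) | i j k.
       (i, j) \<in> St3_indices \<and> (j, k) \<in> St3_indices \<and> i \<noteq> k} \<union>
    {(commutator_word (i, j) (k, l), []) | i j k l.
       (i, j) \<in> St3_indices \<and> (k, l) \<in> St3_indices \<and> i \<noteq> l \<and> j \<noteq> k}"

definition St3 :: "(nat \<times> nat) word set monoid"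
  where "St3 = presented_group St3_indices St3_relations"

definition St3_gens :: "(nat \<times> nat) word set set"
  where "St3_gens = presented_gen St3_indices St3_relations ` St3_indices"

section \<open>Unitary representations and Kazhdan constants\<close>

definition complex_ring :: "complex ring"
  where "complex_ring = \<lparr>carrier = UNIV, mult = (*), one = 1, zero = 0, add = (+)\<rparr>"

text \<open>The ring multiplication and unit that the record type inherits play no role.\<close>

record 'h inner_module = "(complex, 'h) module" +
  inner_prod :: "'h \<Rightarrow> 'h \<Rightarrow> complex"

definition hnorm :: "('h, 'm) inner_module_scheme \<Rightarrow> 'h \<Rightarrow> real"
  where "hnorm H x = sqrt (Re (inner_prod H x x))"

locale complex_hilbert_space = Module.module complex_ring H for H (structure) +
  assumes inner_add_left:
      "\<lbrakk>x \<in> carrier H; y \<in> carrier H; z \<in> carrier H\<rbrakk>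
        \<Longrightarrow> inner_prod H (x \<oplus> y) z = inner_prod H x z + inner_prod H y z"
    and inner_smult_left:
      "\<lbrakk>x \<in> carrier H; y \<in> carrier H\<rbrakk> \<Longrightarrow> inner_prod H (a \<odot> x) y = a * inner_prod H x y"
    and inner_commute:
      "\<lbrakk>x \<in> carrier H; y \<in> carrier H\<rbrakk> \<Longrightarrow> inner_prod H y x = cnj (inner_prod H x y)"
    and inner_pos:
      "\<lbrakk>x \<in> carrier H; x \<noteq> \<zero>\<rbrakk> \<Longrightarrow> 0 < Re (inner_prod H x x)"
    and complete:
      "\<lbrakk>\<And>n. f n \<in> carrier H; \<forall>\<epsilon>>0. \<exists>N. \<forall>m\<ge>N. \<forall>n\<ge>N. hnorm H (f m \<ominus> f n) < \<epsilon>\<rbrakk>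
        \<Longrightarrow> \<exists>l\<in>carrier H. (\<lambda>n. hnorm H (f n \<ominus> l)) \<longlonglongrightarrow> 0"

text \<open>The locale \<open>group_action\<close> makes \<open>\<pi>\<close> a homomorphism into the bijections of \<open>carrier H\<close>.\<close>

locale unitary_rep = group_action G "carrier H" \<pi> + complex_hilbert_space H
  for G (structure) and H (structure) and \<pi> +
  assumes rep_add:
      "\<lbrakk>g \<in> carrier G; x \<in> carrier H; y \<in> carrier H\<rbrakk> \<Longrightarrow> \<pi> g (x \<oplus>\<^bsub>H\<^esub> y) = \<pi> g x \<oplus>\<^bsub>H\<^esub> \<pi> g y"
    and rep_smult:
      "\<lbrakk>g \<in> carrier G; x \<in> carrier H\<rbrakk> \<Longrightarrow> \<pi> g (a \<odot>\<^bsub>H\<^esub> x) = a \<odot>\<^bsub>H\<^esub> \<pi> g x"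
    and rep_inner:
      "\<lbrakk>g \<in> carrier G; x \<in> carrier H; y \<in> carrier H\<rbrakk>
        \<Longrightarrow> inner_prod H (\<pi> g x) (\<pi> g y) = inner_prod H x y"

definition no_invariant_vectors ::
    "('g, 'm) monoid_scheme \<Rightarrow> ('h, 'n) inner_module_scheme \<Rightarrow> ('g \<Rightarrow> 'h \<Rightarrow> 'h) \<Rightarrow> bool"
  where "no_invariant_vectors G H \<pi> \<longleftrightarrow>
    (\<forall>\<xi>\<in>carrier H. (\<forall>g\<in>carrier G. \<pi> g \<xi> = \<xi>) \<longrightarrow> \<xi> = \<zero>\<^bsub>H\<^esub>)"

text \<open>Infima are taken in the extended reals, so that the zero space gives \<open>\<infinity>\<close> rather than an
  unspecified real number.\<close>

definition rep_kazhdan_constant ::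
    "'g set \<Rightarrow> ('h, 'n) inner_module_scheme \<Rightarrow> ('g \<Rightarrow> 'h \<Rightarrow> 'h) \<Rightarrow> ereal"
  where "rep_kazhdan_constant S H \<pi> =
    (INF \<xi>\<in>{\<xi> \<in> carrier H. hnorm H \<xi> = 1}.
       Max ((\<lambda>s. ereal (hnorm H (\<pi> s \<xi> \<ominus>\<^bsub>H\<^esub> \<xi>))) ` S))"

text \<open>HOL cannot quantify over all types inside a term: the infimum ranges over all Hilbert spaces
  whose underlying set is a set of elements of \<open>'h\<close>. A statement that is polymorphic in \<open>'h\<close>
  covers all Hilbert spaces.\<close>

definition kazhdan_constant ::
    "'h itself \<Rightarrow> ('g, 'm) monoid_scheme \<Rightarrow> 'g set \<Rightarrow> ereal"
  where "kazhdan_constant (_ :: 'h itself) G S =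
    Inf {rep_kazhdan_constant S H \<pi> | (H :: 'h inner_module) \<pi>.
           unitary_rep G H \<pi> \<and> no_invariant_vectors G H \<pi>}"

end

theory Submission
  imports Defs
begin

text \<open>Let \<open>\<Delta> = \<Sum>\<^sub>s (1 - s)\<close> over the twelve letters \<open>s = x\<^sub>i\<^sub>j\<close>, \<open>x\<^sub>i\<^sub>j\<^sup>-\<^sup>1\<close>.  In the real group ring,
  \<open>\<Delta>\<^sup>2 - 0.175504 \<Delta>\<close> is a positive combination of elements \<open>\<sigma>(\<xi>\<^sub>k)\<^sup>* \<sigma>(\<xi>\<^sub>k)\<close> and \<open>(1 - g)\<^sup>* (1 - g)\<close>, where
  \<open>\<xi>\<^sub>1, \<dots>, \<xi>\<^sub>4\<close> are explicit and \<open>\<sigma>\<close> runs through the automorphisms that permute the letters (signed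
  permutations of the indices and inverse transposition).  Thus \<open>\<parallel>\<Delta>\<xi>\<parallel>\<^sup>2 \<ge> 0.175504 \<langle>\<Delta>\<xi>, \<xi>\<rangle>\<close> in every
  unitary representation, which forces \<open>\<langle>\<Delta>\<xi>, \<xi>\<rangle> \<ge> 0.175504 \<parallel>\<xi>\<parallel>\<^sup>2\<close> if there are no invariant vectors.
  As \<open>\<langle>\<Delta>\<xi>, \<xi>\<rangle>\<close> is the sum of the six numbers \<open>\<parallel>x\<^sub>i\<^sub>j \<xi> - \<xi>\<parallel>\<^sup>2\<close>, one of them is at least
  \<open>0.175504 / 6 > 0.171028\<^sup>2\<close>.\<close>

section \<open>Words in the twelve elementary letters\<close>

text \<open>The letter \<open>(k, d, b)\<close> stands for \<open>x\<^sub>i\<^sub>j\<close> (if \<open>b\<close>) or its inverse, where \<open>k\<close> is the index different from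
  \<open>i\<close> and \<open>j\<close>, and \<open>d\<close> says whether \<open>(i, j, k)\<close> is a cyclic shift of \<open>(1, 2, 3)\<close>.  In this encoding two root
  subgroups are opposite iff they agree in \<open>k\<close> only, and generate a Heisenberg group iff they
  agree in \<open>d\<close> only.\<close>

datatype idx = I1 | I2 | I3

lemma UNIV_idx: "UNIV = {I1, I2, I3}"
  using idx.exhaust by auto

instance idx :: finite
  by standard (simp add: UNIV_idx)

type_synonym letter = "idx \<times> bool \<times> bool"

fun nxt :: "idx \<Rightarrow> idx" where
  "nxt I1 = I2" | "nxt I2 = I3" | "nxt I3 = I1"

text \<open>The last equation is a default for equal arguments, a case in which
  \<open>comm_word\<close> does not call \<open>third\<close>.\<close>

fun third :: "idx \<Rightarrow> idx \<Rightarrow> idx" where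
  "third I1 I2 = I3" | "third I2 I1 = I3" | "third I1 I3 = I2" | "third I3 I1 = I2"
| "third I2 I3 = I1" | "third I3 I2 = I1" | "third k _ = k"

fun linv :: "letter \<Rightarrow> letter" where
  "linv (k, d, b) = (k, d, \<not> b)"

definition winv :: "letter list \<Rightarrow> letter list" where
  "winv w = rev (map linv w)"

text \<open>\<open>comm_word a b = Some z\<close> expresses the relation \<open>a b = z b a\<close>; opposite letters give \<open>None\<close>.\<close>

fun comm_word :: "letter \<Rightarrow> letter \<Rightarrow> letter list option" where
  "comm_word (k, d, b) (l, e, c) =
    (if k = l then (if d = e then Some [] else None)
     else if d = e then Some [(third k l, \<not> d, (b = c) = ((l = nxt k) = d))]
     else Some [])"

text \<open>\<open>pass a w\<close> moves \<open>a\<close> to the right through \<open>w\<close>, leaving commutators behind, until it meets its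
  inverse.\<close>

fun pass :: "letter \<Rightarrow> letter list \<Rightarrow> letter list option" where
  "pass a [] = None"
| "pass a (b # w) =
    (if b = linv a then Some w
     else case comm_word a b of
       None \<Rightarrow> None
     | Some z \<Rightarrow> (case pass a w of None \<Rightarrow> None | Some r \<Rightarrow> Some (z @ b # r)))"

text \<open>No normal form is computed: the commutators that \<open>pass\<close> leaves behind are
  not processed again. What matters is soundness, \<open>equiv_words_reduce\<close>.\<close>

fun reduce :: "letter list \<Rightarrow> letter list" where
  "reduce [] = []"
| "reduce (a # w) = (case pass a (reduce w) of Some r \<Rightarrow> r | None \<Rightarrow> a # reduce w)"

section \<open>Automorphisms that permute the letters\<close>

fun transinv :: "letter \<Rightarrow> letter" where
  "transinv (k, d, b) = (k, \<not> d, \<not> b)"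

text \<open>Conjugation by the diagonal matrix whose only entry -1 is at \<open>m\<close>: the root
  elements that involve the index \<open>m\<close> are inverted, and these are the ones with
  \<open>k\<close> different from \<open>m\<close>.\<close>

fun flip :: "idx \<Rightarrow> letter \<Rightarrow> letter" where
  "flip m (k, d, b) = (k, d, b = (k = m))"

fun swap12 :: "letter \<Rightarrow> letter" where
  "swap12 (k, d, b) = ((case k of I1 \<Rightarrow> I2 | I2 \<Rightarrow> I1 | I3 \<Rightarrow> I3), \<not> d, b)"

fun rotate3 :: "letter \<Rightarrow> letter" where
  "rotate3 (k, d, b) = (nxt k, d, b)"

text \<open>Every defining relation of the Steinberg group is an instance of
  \<open>comm_word\<close>, so such a \<open>g\<close> extends to an automorphism of the group.
  Stated on letters, the condition is a finite case check.\<close>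

definition letter_aut :: "(letter \<Rightarrow> letter) \<Rightarrow> bool" where
  "letter_aut g \<longleftrightarrow> bij g \<and> (\<forall>a. g (linv a) = linv (g a)) \<and>
    (\<forall>a b. comm_word (g a) (g b) = map_option (map g) (comm_word a b))"

lemma linv_linv [simp]: "linv (linv a) = a"
  by (cases a) simp

lemma winv_simps [simp]: "winv [] = []" "winv (a # w) = winv w @ [linv a]"
  "winv (u @ v) = winv v @ winv u" "winv (winv w) = w"
  by (simp_all add: winv_def rev_map o_def)

lemma all_letter_iff: "(\<forall>a :: letter. P a) \<longleftrightarrow>
  (\<forall>d b. P (I1, d, b) \<and> P (I2, d, b) \<and> P (I3, d, b))"
  by (simp add: split_paired_All) (metis (full_types) idx.exhaust)

lemma sum_letter: "(\<Sum>a\<in>UNIV. f (a :: letter)) =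
    (\<Sum>k\<in>{I1, I2, I3}. \<Sum>d\<in>{True, False}. \<Sum>b\<in>{True, False}. f (k, d, b))"
  unfolding UNIV_idx[symmetric] insert_commute[of True] UNIV_bool[symmetric]
  by (simp add: sum.cartesian_product case_prod_beta flip: UNIV_Times_UNIV)

lemma card_letter [simp]: "card (UNIV :: letter set) = 12"
  using sum_letter[of "\<lambda>_. 1 :: nat"] by simp

text \<open>The inverse is the power \<open>g ^^ (n - 1)\<close>.\<close>

lemma bij_if_finite_order:
  assumes "\<And>a. (g ^^ n) a = a" "n > 0"
  shows "bij g"
proof -
  obtain m where n: "n = Suc m" using assms(2) by (cases n) auto
  have "(g ^^ m) (g a) = a" "g ((g ^^ m) a) = a" for a
    using assms(1)[of a] by (simp_all add: n funpow_swap1)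
  then show ?thesis by (metis bijI')
qed

lemma letter_aut_generators:
  "letter_aut transinv" "letter_aut (flip m)" "letter_aut swap12" "letter_aut rotate3"
proof -
  have b: "bij transinv" "bij (flip m)" "bij swap12"
    by (rule bij_if_finite_order[where n = 2]; force simp: numeral_2_eq_2 split: idx.split)+
  have r: "bij rotate3"
  proof (rule bij_if_finite_order[where n = 3])
    show "(rotate3 ^^ 3) a = a" for a
    proof (cases a)
      case (fields k d b)
      then show ?thesis by (cases k) (simp_all add: numeral_3_eq_3)
    qed
  qed simp
  show "letter_aut transinv"
    unfolding letter_aut_def all_letter_iff by (intro conjI b) auto
  show "letter_aut (flip m)"
    unfolding letter_aut_def all_letter_iff by (intro conjI b; cases m) auto
  show "letter_aut swap12"
    unfolding letter_aut_def all_letter_iff by (intro conjI b) auto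
  show "letter_aut rotate3"
    unfolding letter_aut_def all_letter_iff by (intro conjI r) auto
qed

lemma letter_autD:
  assumes "letter_aut g"
  shows "bij g" "g (linv a) = linv (g a)" "comm_word (g a) (g b) = map_option (map g) (comm_word a b)"
  using assms by (simp_all only: letter_aut_def)

lemma letter_aut_comp:
  assumes g: "letter_aut g" and h: "letter_aut h"
  shows "letter_aut (g \<circ> h)"
proof -
  have "bij (g \<circ> h)" by (intro bij_comp letter_autD(1) g h)
  then show ?thesis
    unfolding letter_aut_def
    by (simp only: o_apply letter_autD(2,3)[OF g] letter_autD(2,3)[OF h] option.map_comp
        list.map_comp simp_thms o_def)
qed

lemma letter_aut_id: "letter_aut id"
  by (simp add: letter_aut_def option.map_id)

lemma map_winv:
  assumes "letter_aut g"
  shows "map g (winv w) = winv (map g w)"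
  by (induction w) (simp_all only: list.map winv_simps map_append letter_autD(2)[OF assms])

text \<open>Transitivity lets the certificate treat the single letter
  \<open>(I3, True, True)\<close>, which is x_12. Rotations bring \<open>k\<close> to
  \<open>I3\<close>, then \<open>swap12\<close> corrects \<open>d\<close> and \<open>flip I1\<close>
  corrects the sign.\<close>

lemma letter_aut_transitive: "\<exists>g. letter_aut g \<and> g a = (I3, True, True)"
proof -
  have comp: "\<exists>h. letter_aut h \<and> h a = c" if "letter_aut g" "\<exists>h. letter_aut h \<and> h (g a) = c"
    for g a c
    using that letter_aut_comp by fastforce
  have base: "\<exists>g. letter_aut g \<and> g (I3, d, b) = (I3, True, True)" for d b
  proof -
    have 1: "\<exists>g. letter_aut g \<and> g (I3, True, True) = (I3, True, True)"
      using letter_aut_id by fastforce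
    have 2: "\<exists>g. letter_aut g \<and> g (I3, True, False) = (I3, True, True)"
      by (rule comp[OF letter_aut_generators(2)[of I1]]) (use 1 in simp)
    have "\<exists>g. letter_aut g \<and> g (I3, False, b) = (I3, True, True)"
      by (rule comp[OF letter_aut_generators(3)]) (use 1 2 in \<open>cases b; simp\<close>)
    then show ?thesis using 1 2 by (cases d; cases b) auto
  qed
  have 2: "\<exists>g. letter_aut g \<and> g (I2, d, b) = (I3, True, True)" for d b
    by (rule comp[OF letter_aut_generators(4)]) (use base in simp)
  have 1: "\<exists>g. letter_aut g \<and> g (I1, d, b) = (I3, True, True)" for d b
    by (rule comp[OF letter_aut_generators(4)]) (use 2 in simp)
  show ?thesis
    by (cases a; rename_tac k d b; case_tac k) (use 1 2 base in auto)
qed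

section \<open>The certificate\<close>

text \<open>An abstract function of conditionally negative type. By \<open>cancel\<close> and
  \<open>commute\<close> it depends only on the group element that a word represents. These
  properties are all that the certificate needs, so it can be checked on words, without any group or
  representation.\<close>

locale length_like =
  fixes D :: "letter list \<Rightarrow> real"
  assumes nonneg: "0 \<le> D w"
    and Nil: "D [] = 0"
    and inverse: "D (winv w) = D w"
    and cancel: "D (u @ a # linv a # v) = D (u @ v)"
    and commute: "comm_word a b = Some z \<Longrightarrow> D (u @ a # b # v) = D (u @ z @ b # a # v)"
    and aut: "letter_aut g \<Longrightarrow> D (map g w) = D w"
    and negative_type: "(\<Sum>x\<leftarrow>xs. fst x) = 0 \<Longrightarrow>
      (\<Sum>x\<leftarrow>xs. \<Sum>y\<leftarrow>xs. fst x * fst y * D (winv (snd x) @ snd y)) \<le> 0"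
begin

text \<open>Quantifying over all contexts makes the relation a congruence by definition, so
  rewriting may take place inside a word.\<close>

definition equiv_words :: "letter list \<Rightarrow> letter list \<Rightarrow> bool" (infix \<open>\<approx>\<close> 50) where
  "u \<approx> v \<longleftrightarrow> (\<forall>p q. D (p @ u @ q) = D (p @ v @ q))"

lemma equiv_words_context: "u \<approx> v \<Longrightarrow> p @ u @ q \<approx> p @ v @ q"
  unfolding equiv_words_def by (metis append.assoc)

lemma equiv_words_Cons: "u \<approx> v \<Longrightarrow> a # u \<approx> a # v"
  using equiv_words_context[of u v "[a]" "[]"] by simp

lemma equiv_words_refl: "u \<approx> u"
  by (simp add: equiv_words_def)

lemma equiv_words_trans [trans]: "u \<approx> v \<Longrightarrow> v \<approx> w \<Longrightarrow> u \<approx> w"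
  by (simp add: equiv_words_def)

lemma equiv_words_D: "u \<approx> v \<Longrightarrow> D u = D v"
  unfolding equiv_words_def by (metis append_Nil append_Nil2)

lemma equiv_words_cancel: "a # linv a # w \<approx> w"
  unfolding equiv_words_def using cancel by simp

lemma equiv_words_cancel_winv: "w @ winv w @ v \<approx> v"
proof (induction w arbitrary: v)
  case (Cons a w)
  have "a # w @ winv w @ linv a # v \<approx> a # linv a # v"
    by (rule equiv_words_Cons[OF Cons.IH])
  also have "\<dots> \<approx> v" by (rule equiv_words_cancel)
  finally show ?case by simp
qed (simp add: equiv_words_refl)

lemma equiv_words_pass: "pass a w = Some r \<Longrightarrow> a # w \<approx> r"
proof (induction w arbitrary: r)
  case (Cons b w)
  show ?case
  proof (cases "b = linv a")
    case True
    then show ?thesis using Cons.prems equiv_words_cancel by simp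
  next
    case False
    with Cons.prems obtain z r' where z: "comm_word a b = Some z" and r': "pass a w = Some r'"
      and r: "r = z @ b # r'"
      by (auto simp del: comm_word.simps split: option.splits)
    have "a # b # w \<approx> z @ b # a # w"
      using commute[OF z] by (simp add: equiv_words_def)
    also have "\<dots> \<approx> z @ b # r'"
      using equiv_words_context[OF Cons.IH[OF r'], of "z @ [b]" "[]"] by simp
    finally show ?thesis by (simp add: r)
  qed
qed simp

lemma equiv_words_reduce: "w \<approx> reduce w"
proof (induction w)
  case (Cons a w)
  have "a # w \<approx> a # reduce w" by (rule equiv_words_Cons[OF Cons.IH])
  also have "\<dots> \<approx> reduce (a # w)"
    by (auto simp: equiv_words_refl split: option.splits dest: equiv_words_pass)
  finally show ?case .
qed (simp add: equiv_words_refl)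

text \<open>If \<open>winv r @ w\<close> rewrites to the empty word, then \<open>w\<close> and
  \<open>r\<close> stand for the same element. The second \<open>reduce\<close> deals with
  commutators that the first one inserted.\<close>

lemma D_eq_if_reduce_Nil:
  assumes "reduce (reduce (winv r @ w)) = []"
  shows "D w = D r"
proof -
  have "winv r @ w \<approx> reduce (winv r @ w)" by (rule equiv_words_reduce)
  also have "\<dots> \<approx> []" using equiv_words_reduce[of "reduce (winv r @ w)"] assms by simp
  finally have "r @ (winv r @ w) @ [] \<approx> r @ [] @ []" by (rule equiv_words_context)
  then have "D (r @ winv r @ w) = D r" using equiv_words_D by fastforce
  then show ?thesis using equiv_words_D[OF equiv_words_cancel_winv] by metis
qed

end

section \<open>A checker for sums of squares\<close>

fun apply_selected :: "int \<Rightarrow> ('a \<Rightarrow> 'a) list \<Rightarrow> 'a \<Rightarrow> 'a" where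
  "apply_selected n [] w = w"
| "apply_selected n (f # fs) w = apply_selected (n div 2) fs (if odd n then f w else w)"

text \<open>A subset of this list, applied in order, yields every signed permutation, with or
  without inverse transposition and inversion of the word. \<open>rotate3\<close> occurs twice to
  give all powers of the rotation, and flipping at \<open>I3\<close> is the product of the two
  flips.\<close>

definition symmetries :: "(letter list \<Rightarrow> letter list) list" where
  "symmetries = [map transinv, map (flip I1), map (flip I2), map swap12, map rotate3, map rotate3, winv]"

fun add_to :: "int \<Rightarrow> letter list \<Rightarrow> int \<Rightarrow> (letter list \<times> int) list \<Rightarrow> (letter list \<times> int) list option" where
  "add_to c w v [] = None"
| "add_to c w v ((r, x) # acc) =
    (if c = 0 then (if reduce (reduce (winv r @ w)) = [] then Some ((r, x + v) # acc) else None)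
     else case add_to (c - 1) w v acc of None \<Rightarrow> None | Some acc' \<Rightarrow> Some ((r, x) # acc'))"

text \<open>A hint \<open>(c, n)\<close> says that the symmetries selected by the binary digits of \<open>n\<close> turn the word into the
  \<open>c\<close>-th representative.\<close>

fun collect :: "(int \<times> letter list) list \<Rightarrow> (int \<times> int) list \<Rightarrow> (letter list \<times> int) list
    \<Rightarrow> (letter list \<times> int) list option" where
  "collect [] [] acc = Some acc"
| "collect ((v, w) # es) ((c, n) # hs) acc =
    (case add_to c (apply_selected n symmetries w) v acc of
      None \<Rightarrow> None | Some acc' \<Rightarrow> collect es hs acc')"
| "collect _ _ _ = None"

type_synonym coeffs = "int \<times> int \<times> int \<times> int"

fun dot :: "coeffs \<Rightarrow> coeffs \<Rightarrow> int" where
  "dot (a1, a2, a3, a4) (b1, b2, b3, b4) = a1 * b1 + a2 * b2 + a3 * b3 + a4 * b4"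

text \<open>The sum of the four elements \<xi>^* \<xi> as a list of weighted words. Each unordered
  pair of rows occurs once with doubled weight, because u^-1 v and v^-1 u have the same
  \<open>D\<close>; the diagonal is left out, because \<open>D\<close> vanishes at the
  identity.\<close>

fun gram :: "(letter list \<times> coeffs) list \<Rightarrow> (int \<times> letter list) list" where
  "gram [] = []"
| "gram ((u, a) # xs) = map (\<lambda>(v, b). (2 * dot a b, winv u @ v)) xs @ gram xs"

context length_like
begin

lemma D_apply_selected: "(\<And>f w. f \<in> set fs \<Longrightarrow> D (f w) = D w) \<Longrightarrow> D (apply_selected n fs w) = D w"
  by (induction fs arbitrary: n w) auto

lemma D_symmetries: "D (apply_selected n symmetries w) = D w"
  by (rule D_apply_selected) (auto simp: symmetries_def inverse aut letter_aut_generators)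

definition total :: "(letter list \<times> int) list \<Rightarrow> real" where
  "total acc = (\<Sum>(r, x)\<leftarrow>acc. real_of_int x * D r)"

lemma total_add_to: "add_to c w v acc = Some acc' \<Longrightarrow> total acc' = total acc + v * D w"
proof (induction c w v acc arbitrary: acc' rule: add_to.induct)
  case (2 c w v r x acc)
  then show ?case
    by (auto simp: total_def algebra_simps D_eq_if_reduce_Nil[of r w] split: if_splits option.splits)
qed simp

lemma total_collect:
  "collect es hs acc = Some acc' \<Longrightarrow> total acc' = total acc + (\<Sum>(v, w)\<leftarrow>es. real_of_int v * D w)"
proof (induction es hs acc rule: collect.induct)
  case (2 v w es c n hs acc)
  then show ?case by (auto simp: total_add_to D_symmetries split: option.splits)
qed simp_all

lemma D_winv_append_self: "D (winv u @ u) = 0"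
  using equiv_words_D[OF equiv_words_cancel_winv[of "winv u" "[]"]] Nil by simp

lemma D_winv_append_commute: "D (winv u @ v) = D (winv v @ u)"
  using inverse[of "winv u @ v"] by simp

lemma double_sum_gram:
  "(\<Sum>x\<leftarrow>xs. \<Sum>y\<leftarrow>xs. dot (snd x) (snd y) * D (winv (fst x) @ fst y)) = (\<Sum>(v, w)\<leftarrow>gram xs. real_of_int v * D w)"
proof (induction xs)
  case (Cons x xs)
  obtain u a where x: "x = (u, a)" by (cases x)
  have c: "dot b c = dot c b" for b c by (cases b; cases c) simp
  have "(\<Sum>y\<leftarrow>xs. dot (snd y) a * D (winv (fst y) @ u)) = (\<Sum>y\<leftarrow>xs. dot a (snd y) * D (winv u @ fst y))"
    by (simp add: D_winv_append_commute[of _ u] c[of _ a])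
  moreover have "(\<Sum>(v, w)\<leftarrow>map (\<lambda>(v, b). (2 * dot a b, winv u @ v)) xs. real_of_int v * D w)
      = 2 * (\<Sum>y\<leftarrow>xs. dot a (snd y) * D (winv u @ fst y))"
    by (simp add: o_def case_prod_beta sum_list_const_mult[symmetric] mult.assoc)
  ultimately show ?case
    using Cons.IH by (simp add: x D_winv_append_self sum_list_addf)
qed simp

text \<open>The form \<open>dot\<close> is a sum of four forms of rank one, and negative type
  applies to each. The hypotheses say that the four group ring elements lie in the augmentation
  ideal.\<close>

lemma gram_nonpos:
  assumes "(\<Sum>x\<leftarrow>xs. fst (snd x)) = 0" "(\<Sum>x\<leftarrow>xs. fst (snd (snd x))) = 0"
    "(\<Sum>x\<leftarrow>xs. fst (snd (snd (snd x)))) = 0" "(\<Sum>x\<leftarrow>xs. snd (snd (snd (snd x)))) = 0"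
  shows "(\<Sum>(v, w)\<leftarrow>gram xs. real_of_int v * D w) \<le> 0"
proof -
  have *: "(\<Sum>x\<leftarrow>xs. \<Sum>y\<leftarrow>xs. real_of_int (f x * f y) * D (winv (fst x) @ fst y)) \<le> 0"
    if "(\<Sum>x\<leftarrow>xs. f x) = 0" for f :: "letter list \<times> coeffs \<Rightarrow> int"
  proof -
    have "(\<Sum>x\<leftarrow>xs. real_of_int (f x)) = real_of_int (\<Sum>x\<leftarrow>xs. f x)" by (induction xs) simp_all
    then show ?thesis
      using negative_type[of "map (\<lambda>x. (real_of_int (f x), fst x)) xs"] that by (simp add: o_def)
  qed
  have "real_of_int (dot a b) = real_of_int (fst a * fst b) + real_of_int (fst (snd a) * fst (snd b))
      + real_of_int (fst (snd (snd a)) * fst (snd (snd b)))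
      + real_of_int (snd (snd (snd a)) * snd (snd (snd b)))" for a b
    by (cases a; cases b) simp
  then have "(\<Sum>(v, w)\<leftarrow>gram xs. real_of_int v * D w) =
     (\<Sum>x\<leftarrow>xs. \<Sum>y\<leftarrow>xs. real_of_int (fst (snd x) * fst (snd y)) * D (winv (fst x) @ fst y))
   + (\<Sum>x\<leftarrow>xs. \<Sum>y\<leftarrow>xs. real_of_int (fst (snd (snd x)) * fst (snd (snd y))) * D (winv (fst x) @ fst y))
   + (\<Sum>x\<leftarrow>xs. \<Sum>y\<leftarrow>xs. real_of_int (fst (snd (snd (snd x))) * fst (snd (snd (snd y)))) * D (winv (fst x) @ fst y))
   + (\<Sum>x\<leftarrow>xs. \<Sum>y\<leftarrow>xs. real_of_int (snd (snd (snd (snd x))) * snd (snd (snd (snd y)))) * D (winv (fst x) @ fst y))"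
    unfolding double_sum_gram[symmetric] by (simp only: distrib_right sum_list_addf)
  then show ?thesis using *[OF assms(1)] *[OF assms(2)] *[OF assms(3)] *[OF assms(4)] by linarith
qed

end

text \<open>The rows are group elements \<open>g\<close> together with the coefficients at \<open>g\<close> of four elements of the group ring,
  found by semidefinite programming (a solution of rank four, rounded to integers after scaling
  by 300000).\<close>

definition certificate_vectors :: "(letter list \<times> coeffs) list" where
  "certificate_vectors = [
    ([], -1367445, -899538, -25864, -120354),
    ([(I1,True,False), (I3,True,False)], 50202, 233337, -403758, -136681),
    ([(I2,True,False), (I1,False,False)], -503712, -109034, 110653, -57513),
    ([(I3,False,False)], 181911, 986662, 0, 0),
    ([(I2,True,False), (I1,False,True)], -314282, 49977, -94695, -296549),
    ([(I3,False,True), (I2,False,True)], -60123, 143206, -15993, -191864),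
    ([(I3,True,True), (I2,True,True)], 6668, 141016, -57266, 79473),
    ([(I3,False,False), (I2,False,True)], -80480, -304693, -23237, 73762),
    ([(I3,True,False), (I2,False,False)], 63665, -41165, 443569, 0),
    ([(I3,True,False), (I1,True,False)], 40597, -164942, 358073, 87266),
    ([(I2,True,False), (I3,True,True)], -779905, 44374, 101152, 85075),
    ([(I3,False,True), (I1,False,True)], 327566, 53842, -26460, 337129),
    ([(I2,True,True), (I1,False,True)], 135581, -263779, 17615, 59110),
    ([(I1,False,False), (I2,False,False)], -6072, -18359, -381599, -1061),
    ([(I3,True,False), (I2,False,True)], 132060, 45559, 156878, 69577),
    ([(I2,False,False), (I1,False,False)], 144806, -102265, 198358, 114765),
    ([(I2,True,False), (I1,True,False)], 237411, -111697, -79455, -247349),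
    ([(I1,True,False), (I2,True,False)], -289105, -102691, 89627, 158168),
    ([(I1,True,True), (I3,True,False)], -26580, -187529, -147336, -18169),
    ([(I1,False,True), (I3,False,True)], -123979, 115991, 46245, -138269),
    ([(I3,False,False), (I1,False,False)], 183615, -51684, 44168, -93729),
    ([(I3,True,True)], 374094, -177955, -285270, 81913),
    ([(I3,False,True), (I2,False,False)], 12000, 15793, 5459, -170279),
    ([(I3,True,True), (I1,False,True)], 155691, 173380, 66568, -129711),
    ([(I2,True,False), (I3,True,False)], -549973, -18633, 38043, 279746),
    ([(I1,False,False)], -17202, 313201, 428939, 86501),
    ([(I3,True,False), (I2,True,False)], 192322, -142682, -183671, 27569),
    ([(I3,True,False), (I1,False,False)], 250467, 89381, -336609, -285595),
    ([(I2,True,True), (I1,True,False)], 39180, -351019, 93581, 135525),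
    ([(I2,True,False)], 2246127, 0, 0, 0),
    ([(I2,False,True), (I3,False,True)], 64501, -30943, 119475, 68886),
    ([(I3,True,False)], -190666, 479027, -142637, 66543),
    ([(I3,False,True), (I1,True,False)], -108283, 290568, -165959, -11788),
    ([(I3,False,False), (I2,True,False)], -420657, -96706, 51406, 87903)]"

text \<open>The quantity to be bounded below, scaled by \<open>12 * 300000 ^ 2 = 1080000000000\<close>; the leading coefficient is
  \<open>24 - 0.175504\<close> times that number.\<close>

definition target :: "(int \<times> letter list) list" where
  "target = (25730455680000, [(I3, True, True)]) #
    map (\<lambda>t. (- 1080000000000, [(I3, True, True), t]))
      [(I3,True,True), (I2,False,True), (I2,False,False), (I3,False,True), (I3,False,False),
       (I1,True,True), (I1,True,False), (I2,True,True), (I2,True,False), (I1,False,True),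
       (I1,False,False)]"

text \<open>Words to which the symmetries carry all terms of \<open>target\<close> and of the Gram
  sum, so that coefficients can be added up orbit by orbit.\<close>

definition representatives :: "letter list list" where
  "representatives = [
    [(I3,True,True)], [(I3,True,True), (I3,True,True)], [(I3,True,True), (I2,False,True)],
    [(I3,True,True), (I3,False,True)], [(I3,True,True), (I3,False,False)],
    [(I3,True,True), (I1,True,True)],
    [(I3,True,True), (I1,True,True), (I2,True,False), (I1,False,False)],
    [(I3,True,True), (I1,True,True), (I3,False,False)],
    [(I3,True,True), (I1,True,True), (I2,True,False), (I1,False,True)],
    [(I3,True,True), (I1,True,True), (I3,False,True), (I2,False,True)],
    [(I3,True,True), (I1,True,True), (I3,True,True), (I2,True,True)],
    [(I3,True,True), (I1,True,True), (I2,True,False), (I3,True,True)],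
    [(I3,True,True), (I1,True,True), (I3,False,True), (I1,False,True)],
    [(I3,True,True), (I1,True,True), (I2,True,True), (I1,False,True)],
    [(I3,True,True), (I1,True,True), (I3,True,False), (I2,False,True)],
    [(I3,True,True), (I1,True,True), (I1,True,True), (I3,True,False)],
    [(I3,True,True), (I1,True,True), (I1,False,True), (I3,False,True)],
    [(I3,True,True), (I1,True,True), (I3,False,False), (I1,False,False)],
    [(I3,True,True), (I1,True,True), (I3,True,True)],
    [(I3,True,True), (I1,True,True), (I3,False,True), (I2,False,False)],
    [(I3,True,True), (I1,True,True), (I3,True,True), (I1,False,True)],
    [(I3,True,True), (I1,True,True), (I2,True,False), (I3,True,False)],
    [(I3,True,True), (I1,True,True), (I1,False,False)],
    [(I3,True,True), (I1,True,True), (I2,True,False)],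
    [(I3,True,True), (I1,True,True), (I2,False,True), (I3,False,True)],
    [(I3,True,True), (I1,True,True), (I3,False,False), (I2,True,False)],
    [(I1,False,True), (I2,True,True), (I3,False,True), (I2,False,True)],
    [(I1,False,True), (I2,True,True), (I3,True,True), (I2,True,True)],
    [(I1,False,True), (I2,True,True), (I3,False,False), (I2,False,True)],
    [(I1,False,True), (I2,True,True), (I1,False,True), (I3,False,True)],
    [(I1,False,True), (I2,True,True), (I3,True,True)],
    [(I1,False,True), (I2,True,True), (I3,True,True), (I1,False,True)],
    [(I1,False,True), (I2,True,True), (I2,True,True), (I1,True,False)],
    [(I1,False,True), (I2,True,True), (I3,False,True), (I1,True,False)],
    [(I1,False,False), (I2,True,True), (I2,False,False), (I1,False,False)],
    [(I1,False,False), (I2,True,True), (I1,True,True), (I3,True,False)],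
    [(I1,False,False), (I2,True,True), (I2,True,True), (I1,True,False)],
    [(I2,False,False), (I3,False,False), (I3,True,True), (I2,True,True)],
    [(I2,False,False), (I3,False,False), (I2,True,False), (I3,True,True)],
    [(I2,False,False), (I3,False,False), (I1,False,False), (I2,False,False)],
    [(I2,False,False), (I3,False,False), (I3,False,False), (I1,False,False)],
    [(I2,True,False), (I3,True,False), (I3,False,False), (I2,False,True)],
    [(I2,True,False), (I3,True,False), (I3,True,False), (I1,True,False)],
    [(I2,True,False), (I3,True,False), (I3,False,True), (I1,False,True)],
    [(I2,True,False), (I3,True,False), (I2,True,False), (I1,True,False)],
    [(I2,True,False), (I3,True,False), (I3,False,True), (I2,False,False)],
    [(I2,True,False), (I3,True,False), (I2,True,False), (I3,True,False)],
    [(I2,True,False), (I3,True,False), (I3,True,False), (I2,True,False)],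
    [(I2,False,True), (I3,True,True), (I3,False,False), (I2,True,False)]]"

text \<open>The first twelve entries belong to \<open>target\<close>, the remaining 561 to the pairs
  of rows. They need no trust: \<open>add_to\<close> verifies each match, and a wrong hint makes
  \<open>collect\<close> fail.\<close>

definition hints :: "(int \<times> int) list" where
  "hints = [
    (0,0), (1,0), (2,56), (2,62), (3,0), (4,0), (5,0), (5,6), (5,11), (5,13), (2,53), (2,51),
    (5,25), (2,22), (0,1), (2,18), (5,8), (5,11), (5,12), (2,58), (5,4), (5,22), (5,5), (2,16),
    (5,49), (2,60), (5,62), (5,57), (5,54), (5,31), (5,24), (5,1), (0,0), (5,14), (2,53), (5,18),
    (0,28), (5,9), (2,49), (5,59), (0,18), (5,19), (0,2), (2,54), (2,57), (6,0), (7,0), (8,0),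
    (9,0), (10,0), (7,78), (0,29), (0,19), (11,0), (12,0), (13,0), (4,29), (14,0), (7,29), (7,13),
    (5,13), (15,0), (16,0), (17,0), (18,0), (19,0), (20,0), (21,0), (22,0), (7,123), (7,117),
    (19,71), (23,0), (24,0), (2,23), (3,0), (25,0), (5,7), (1,24), (26,0), (27,0), (28,0), (22,15),
    (23,15), (2,53), (27,8), (15,7), (4,16), (24,126), (7,16), (4,24), (7,24), (13,15), (29,0),
    (0,1), (30,0), (25,87), (31,0), (2,55), (0,16), (0,2), (5,20), (32,0), (0,24), (8,74), (5,15),
    (33,0), (5,26), (30,53), (27,56), (24,3), (0,19), (7,14), (22,19), (19,3), (27,53), (5,24),
    (23,3), (7,8), (28,9), (5,54), (30,22), (7,70), (18,5), (0,28), (3,3), (27,62), (19,79),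
    (7,75), (5,3), (22,30), (7,3), (30,27), (2,61), (18,8), (4,3), (14,59), (0,18), (28,4),
    (27,66), (26,4), (33,12), (26,12), (2,51), (0,3), (1,16), (32,12), (24,20), (34,0), (3,28),
    (19,112), (35,0), (2,59), (27,12), (5,11), (23,3), (5,16), (2,49), (14,11), (14,20), (31,4),
    (36,0), (0,28), (13,3), (30,4), (24,114), (5,28), (37,0), (15,17), (20,17), (36,22), (38,0),
    (5,58), (25,17), (39,0), (19,10), (10,17), (9,17), (24,17), (19,70), (7,58), (40,0), (22,17),
    (1,17), (6,17), (12,17), (28,20), (16,17), (13,17), (7,125), (19,127), (0,25), (24,64), (2,17),
    (36,117), (41,0), (36,118), (42,0), (14,1), (43,0), (14,18), (24,120), (32,118), (19,18),
    (44,0), (11,18), (44,114), (34,57), (36,95), (0,18), (45,0), (2,18), (46,0), (5,9), (47,59),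
    (18,9), (7,93), (18,18), (17,18), (27,123), (6,18), (20,18), (34,118), (4,3), (12,21), (40,4),
    (23,58), (11,21), (7,70), (44,7), (19,21), (24,127), (34,62), (44,117), (5,62), (24,68),
    (47,60), (13,21), (38,4), (23,21), (45,7), (6,21), (34,93), (19,123), (14,61), (22,21),
    (18,14), (3,17), (2,19), (34,28), (8,92), (24,56), (0,28), (1,19), (2,51), (6,27), (23,27),
    (14,0), (26,48), (6,51), (14,51), (19,76), (31,24), (7,56), (5,51), (4,19), (5,60), (13,27),
    (7,84), (36,28), (0,19), (24,74), (48,56), (44,125), (16,29), (28,51), (7,119), (2,23), (33,5),
    (21,53), (19,58), (14,8), (12,29), (37,12), (27,116), (36,26), (36,127), (19,94), (7,29),
    (5,50), (4,29), (21,29), (28,30), (19,74), (0,29), (19,0), (35,95), (7,65), (29,78), (7,20),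
    (20,15), (4,16), (5,4), (7,4), (39,62), (33,23), (19,15), (2,16), (17,15), (14,15), (1,2),
    (5,20), (14,60), (27,125), (42,61), (0,2), (41,61), (18,15), (25,15), (3,2), (14,28), (44,8),
    (13,28), (11,28), (24,112), (19,28), (38,119), (0,16), (47,53), (22,28), (5,49), (7,73),
    (19,75), (18,28), (36,87), (20,28), (24,28), (5,1), (19,95), (24,77), (3,28), (18,1), (36,12),
    (22,9), (20,119), (36,2), (20,127), (6,9), (2,61), (27,72), (30,6), (26,6), (5,22), (18,18),
    (14,9), (27,64), (30,57), (3,28), (14,1), (35,12), (5,9), (24,30), (30,49), (27,94), (0,0),
    (17,56), (37,25), (36,69), (40,25), (7,23), (30,24), (21,16), (29,121), (34,64), (0,19),
    (22,55), (2,60), (38,25), (7,56), (10,56), (5,55), (35,124), (25,56), (29,54), (8,112),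
    (26,30), (0,29), (28,54), (35,26), (14,53), (20,87), (30,21), (19,80), (30,30), (3,17), (5,62),
    (35,48), (19,58), (3,0), (0,17), (24,6), (21,53), (37,22), (17,55), (9,55), (44,17), (21,31),
    (5,56), (7,24), (27,81), (43,17), (2,60), (34,24), (14,55), (41,17), (22,55), (42,17), (30,23),
    (25,55), (35,117), (0,3), (44,22), (9,48), (22,63), (28,51), (34,31), (26,81), (5,31), (7,48),
    (7,31), (25,48), (15,24), (0,29), (36,53), (23,48), (14,48), (2,50), (40,30), (36,66), (34,16),
    (23,63), (22,48), (8,63), (19,12), (22,63), (21,23), (35,123), (14,24), (2,50), (19,63),
    (28,58), (2,59), (14,63), (45,50), (38,73), (18,6), (9,6), (34,83), (21,14), (24,119), (19,21),
    (19,27), (10,114), (28,1), (24,74), (2,17), (36,80), (23,13), (46,53), (7,1), (19,18), (4,1),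
    (24,1), (27,72), (9,1), (36,87), (19,114), (30,49), (21,1), (19,75), (19,28), (27,49), (24,73),
    (42,12), (20,24), (7,5), (2,59), (4,3), (7,77), (33,0), (5,5), (44,120), (22,24), (32,122),
    (2,18), (22,25), (0,24), (18,9), (2,49), (27,57), (14,60), (23,15), (5,9), (7,74), (1,2),
    (7,4), (19,69), (35,83), (38,122), (23,23), (41,5), (8,23), (19,23), (7,23), (14,4), (24,70),
    (2,19), (32,115), (27,57), (14,20), (29,17), (15,20), (28,17), (30,57), (23,60), (14,60),
    (21,60), (24,9), (30,59), (0,28), (14,11), (40,58), (0,0), (16,11), (2,20), (26,122), (4,0),
    (5,18), (0,2), (7,114), (2,18), (23,55), (2,55), (7,24), (30,10), (2,20), (44,2), (2,53),
    (12,16), (0,16), (8,16), (7,67), (23,16), (30,61), (28,61), (0,24), (21,16), (33,21), (27,91),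
    (4,18), (28,49), (0,18), (29,115), (24,59), (5,20), (30,27), (0,1), (19,70), (0,17), (20,10),
    (19,76), (7,13), (31,18)]"

text \<open>The collected coefficients are the weights of the terms (1 - g)^* (1 - g). They only
  have to be nonnegative, so rounded data suffice and no exact identity with the squares is
  required.\<close>

definition certificate_valid :: bool where
  "certificate_valid \<longleftrightarrow>
    (case collect (target @ gram certificate_vectors) hints (map (\<lambda>r. (r, 0)) representatives) of
       None \<Rightarrow> False
     | Some acc \<Rightarrow> list_all (\<lambda>(r, x). 0 \<le> x) acc)"

lemma certificate_valid: certificate_valid
  by code_simp

context length_like
begin

text \<open>This is the inequality between \<Delta>^2 and \<Delta>, read at one letter. The target
  plus the Gram sum is a nonnegative combination of values of \<open>D\<close>, and the Gram sum is
  at most 0, so the target is nonnegative.\<close>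

lemma sum_two_letters_le:
  "(\<Sum>t\<in>UNIV. D [(I3, True, True), t]) \<le> (24 - 0.175504) * D [(I3, True, True)]"
proof -
  let ?x = "(I3, True, True) :: letter"
  obtain acc where
    col: "collect (target @ gram certificate_vectors) hints (map (\<lambda>r. (r, 0)) representatives) = Some acc"
    and pos: "list_all (\<lambda>(r, x). 0 \<le> x) acc"
    using certificate_valid unfolding certificate_valid_def by (auto split: option.splits)
  have "total (map (\<lambda>r. (r, 0)) rs) = 0" for rs by (induction rs) (simp_all add: total_def)
  moreover have "0 \<le> total acc"
    using pos by (induction acc) (auto simp: total_def nonneg)
  ultimately have "0 \<le> (\<Sum>(v, w)\<leftarrow>target. real_of_int v * D w) + (\<Sum>(v, w)\<leftarrow>gram certificate_vectors. real_of_int v * D w)"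
    using total_collect[OF col] by simp
  moreover have "(\<Sum>(v, w)\<leftarrow>gram certificate_vectors. real_of_int v * D w) \<le> 0"
    by (rule gram_nonpos) (simp_all add: certificate_vectors_def)
  \<comment> \<open>The inverse of \<open>?x\<close> is the one letter missing from
    \<open>target\<close>; its term is 0.\<close>
  moreover have "D [?x, (I3, True, False)] = 0"
    using cancel[of "[]" ?x "[]"] Nil by simp
  ultimately show ?thesis by (simp add: target_def sum_letter)
qed

end

section \<open>Spectral gaps on a Hilbert space\<close>

lemma geometric_sum_le:
  fixes r :: real
  assumes "0 \<le> r" "r < 1"
  shows "(\<Sum>i<n. r ^ i) \<le> 1 / (1 - r)"
  using assms by (simp add: sum_gp_strict divide_right_mono)

section \<open>The underlying real Hilbert space\<close>

context complex_hilbert_space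
begin

definition real_inner_prod :: "'a \<Rightarrow> 'a \<Rightarrow> real" (\<open>\<llangle>_, _\<rrangle>\<close>) where
  "\<llangle>x, y\<rrangle> = Re (inner_prod H x y)"

definition rscale :: "real \<Rightarrow> 'a \<Rightarrow> 'a" (infixr \<open>\<cdot>\<close> 75) where
  "c \<cdot> x = complex_of_real c \<odot>\<^bsub>H\<^esub> x"

lemma carrier_complex_ring [simp]: "c \<in> carrier complex_ring"
  by (simp add: complex_ring_def)

lemma rscale_closed [simp]: "x \<in> carrier H \<Longrightarrow> c \<cdot> x \<in> carrier H"
  by (simp add: rscale_def)

lemma rip_add_left: "\<lbrakk>x \<in> carrier H; y \<in> carrier H; z \<in> carrier H\<rbrakk> \<Longrightarrow>
    \<llangle>x \<oplus>\<^bsub>H\<^esub> y, z\<rrangle> = \<llangle>x, z\<rrangle> + \<llangle>y, z\<rrangle>"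
  by (simp add: real_inner_prod_def inner_add_left)

lemma rip_scale_left: "\<lbrakk>x \<in> carrier H; y \<in> carrier H\<rbrakk> \<Longrightarrow> \<llangle>c \<cdot> x, y\<rrangle> = c * \<llangle>x, y\<rrangle>"
  by (simp add: real_inner_prod_def rscale_def inner_smult_left)

lemma rip_commute: "\<lbrakk>x \<in> carrier H; y \<in> carrier H\<rbrakk> \<Longrightarrow> \<llangle>x, y\<rrangle> = \<llangle>y, x\<rrangle>"
  by (simp add: real_inner_prod_def inner_commute[of x y])

lemma rip_add_right: "\<lbrakk>x \<in> carrier H; y \<in> carrier H; z \<in> carrier H\<rbrakk> \<Longrightarrow>
    \<llangle>z, x \<oplus>\<^bsub>H\<^esub> y\<rrangle> = \<llangle>z, x\<rrangle> + \<llangle>z, y\<rrangle>"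
  by (simp add: rip_commute[of z] rip_add_left)

lemma rip_scale_right: "\<lbrakk>x \<in> carrier H; y \<in> carrier H\<rbrakk> \<Longrightarrow> \<llangle>x, c \<cdot> y\<rrangle> = c * \<llangle>x, y\<rrangle>"
  by (simp add: rip_commute[of x] rip_scale_left)

lemma rip_zero_left: "y \<in> carrier H \<Longrightarrow> \<llangle>\<zero>\<^bsub>H\<^esub>, y\<rrangle> = 0"
  using rip_add_left[of "\<zero>\<^bsub>H\<^esub>" "\<zero>\<^bsub>H\<^esub>" y] by simp

lemma a_inv_eq_rscale: "x \<in> carrier H \<Longrightarrow> \<ominus>\<^bsub>H\<^esub> x = (- 1) \<cdot> x"
proof -
  assume x: "x \<in> carrier H"
  have "\<ominus>\<^bsub>complex_ring\<^esub> \<one>\<^bsub>complex_ring\<^esub> = - 1"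
    by (rule R.minus_equality) (simp_all add: complex_ring_def)
  then show ?thesis
    using x smult_l_minus[of "\<one>\<^bsub>complex_ring\<^esub>" x] by (simp add: rscale_def)
qed

lemma minus_eq_rscale: "\<lbrakk>x \<in> carrier H; y \<in> carrier H\<rbrakk> \<Longrightarrow> x \<ominus>\<^bsub>H\<^esub> y = x \<oplus>\<^bsub>H\<^esub> (- 1) \<cdot> y"
  by (simp add: a_minus_def a_inv_eq_rscale)

lemmas rip_simps = rip_add_left rip_add_right rip_scale_left rip_scale_right

lemma rip_pos: "\<lbrakk>x \<in> carrier H; x \<noteq> \<zero>\<^bsub>H\<^esub>\<rbrakk> \<Longrightarrow> 0 < \<llangle>x, x\<rrangle>"
  by (simp add: real_inner_prod_def inner_pos)

lemma rip_nonneg: "x \<in> carrier H \<Longrightarrow> 0 \<le> \<llangle>x, x\<rrangle>"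
  by (metis less_eq_real_def rip_pos rip_zero_left)

lemma hnorm_eq: "hnorm H x = sqrt \<llangle>x, x\<rrangle>"
  by (simp add: hnorm_def real_inner_prod_def)

lemma hnorm_nonneg: "x \<in> carrier H \<Longrightarrow> 0 \<le> hnorm H x"
  by (simp add: hnorm_eq rip_nonneg)

lemma hnorm_power2: "x \<in> carrier H \<Longrightarrow> (hnorm H x)\<^sup>2 = \<llangle>x, x\<rrangle>"
  by (simp add: hnorm_eq rip_nonneg)

lemma rip_le_hnorm:
  assumes x: "x \<in> carrier H" and y: "y \<in> carrier H"
  shows "\<llangle>x, y\<rrangle> \<le> hnorm H x * hnorm H y"
proof (cases "y = \<zero>\<^bsub>H\<^esub>")
  case True
  then show ?thesis using x hnorm_nonneg[OF x] hnorm_nonneg[OF y] by (simp add: rip_commute[of x] rip_zero_left)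
next
  case False
  then have pos: "0 < \<llangle>y, y\<rrangle>" using rip_pos y by simp
  \<comment> \<open>The minimiser of the squared norm of x + t y.\<close>
  define t where "t = - \<llangle>x, y\<rrangle> / \<llangle>y, y\<rrangle>"
  have "0 \<le> \<llangle>x \<oplus>\<^bsub>H\<^esub> t \<cdot> y, x \<oplus>\<^bsub>H\<^esub> t \<cdot> y\<rrangle>" using x y by (intro rip_nonneg) simp
  also have "\<dots> = \<llangle>x, x\<rrangle> + 2 * t * \<llangle>x, y\<rrangle> + t * t * \<llangle>y, y\<rrangle>"
    using x y by (simp add: rip_simps rip_commute[of y x] algebra_simps)
  also have "\<dots> = \<llangle>x, x\<rrangle> - \<llangle>x, y\<rrangle>\<^sup>2 / \<llangle>y, y\<rrangle>"
    using pos by (simp add: t_def field_simps power2_eq_square)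
  finally have "\<llangle>x, y\<rrangle>\<^sup>2 \<le> \<llangle>x, x\<rrangle> * \<llangle>y, y\<rrangle>" using pos by (simp add: field_simps)
  then have "\<llangle>x, y\<rrangle>\<^sup>2 \<le> (hnorm H x * hnorm H y)\<^sup>2"
    using x y by (simp add: power_mult_distrib hnorm_power2)
  then show ?thesis by (rule power2_le_imp_le) (simp add: hnorm_nonneg x y)
qed

lemma hnorm_triangle:
  assumes x: "x \<in> carrier H" and y: "y \<in> carrier H"
  shows "hnorm H (x \<oplus>\<^bsub>H\<^esub> y) \<le> hnorm H x + hnorm H y"
proof (rule power2_le_imp_le)
  have "(hnorm H (x \<oplus>\<^bsub>H\<^esub> y))\<^sup>2 = \<llangle>x, x\<rrangle> + 2 * \<llangle>x, y\<rrangle> + \<llangle>y, y\<rrangle>"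
    using x y by (simp add: hnorm_power2 rip_simps rip_commute[of y x])
  also have "\<dots> \<le> (hnorm H x + hnorm H y)\<^sup>2"
    using rip_le_hnorm[OF x y] x y by (simp add: power2_sum hnorm_power2)
  finally show "(hnorm H (x \<oplus>\<^bsub>H\<^esub> y))\<^sup>2 \<le> (hnorm H x + hnorm H y)\<^sup>2" .
qed (simp add: hnorm_nonneg x y)

lemma hnorm_minus_commute:
  assumes "x \<in> carrier H" "y \<in> carrier H"
  shows "hnorm H (x \<ominus>\<^bsub>H\<^esub> y) = hnorm H (y \<ominus>\<^bsub>H\<^esub> x)"
  using assms by (simp add: hnorm_eq minus_eq_rscale rip_simps rip_commute[of y x])

text \<open>Telescoping bounds the distance from \<open>f n\<close> to any later term by the tail K
  r^n / (1 - r) of a geometric series; completeness then gives the limit.\<close>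

lemma Cauchy_if_geometric:
  assumes f: "\<And>n. f n \<in> carrier H"
    and step: "\<And>n. hnorm H (f (Suc n) \<ominus>\<^bsub>H\<^esub> f n) \<le> K * r ^ n"
    and r: "0 \<le> r" "r < 1"
  shows "\<exists>l\<in>carrier H. (\<lambda>n. hnorm H (f n \<ominus>\<^bsub>H\<^esub> l)) \<longlonglongrightarrow> 0"
proof (rule complete[OF f], intro allI impI)
  fix \<epsilon> :: real assume "\<epsilon> > 0"
  have "0 \<le> hnorm H (f (Suc 0) \<ominus>\<^bsub>H\<^esub> f 0)" using f by (simp add: hnorm_nonneg)
  then have K: "0 \<le> K" using step[of 0] by simp
  have part: "hnorm H (f (n + j) \<ominus>\<^bsub>H\<^esub> f n) \<le> K * r ^ n * (\<Sum>i<j. r ^ i)" for n j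
  proof (induction j)
    case 0
    have "f n \<ominus>\<^bsub>H\<^esub> f n = \<zero>\<^bsub>H\<^esub>" using f by (simp add: a_minus_def r_neg)
    then show ?case by (simp add: hnorm_eq rip_zero_left)
  next
    case (Suc j)
    let ?a = "f (Suc (n + j)) \<ominus>\<^bsub>H\<^esub> f (n + j)" and ?b = "f (n + j) \<ominus>\<^bsub>H\<^esub> f n"
    have "f (n + Suc j) \<ominus>\<^bsub>H\<^esub> f n = ?a \<oplus>\<^bsub>H\<^esub> ?b"
      using f by (simp add: a_minus_def a_assoc r_neg1)
    then have "hnorm H (f (n + Suc j) \<ominus>\<^bsub>H\<^esub> f n) \<le> hnorm H ?a + hnorm H ?b"
      using f by (simp add: hnorm_triangle)
    also have "\<dots> \<le> K * r ^ (n + j) + K * r ^ n * (\<Sum>i<j. r ^ i)"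
      using step[of "n + j"] Suc.IH by simp
    finally show ?case by (simp add: algebra_simps power_add)
  qed
  have bound: "hnorm H (f m \<ominus>\<^bsub>H\<^esub> f n) \<le> K / (1 - r) * r ^ n" if "n \<le> m" for m n
  proof -
    have "(\<Sum>i<m - n. r ^ i) \<le> 1 / (1 - r)"
      using r by (rule geometric_sum_le)
    then have "K * r ^ n * (\<Sum>i<m - n. r ^ i) \<le> K * r ^ n * (1 / (1 - r))"
      using K r by (intro mult_left_mono) simp_all
    then show ?thesis using part[of n "m - n"] that by (simp add: mult_ac)
  qed
  have "(\<lambda>n. K / (1 - r) * r ^ n) \<longlonglongrightarrow> K / (1 - r) * 0"
    by (intro tendsto_mult tendsto_const LIMSEQ_power_zero) (use r in simp)
  then have "\<forall>\<^sub>F n in sequentially. K / (1 - r) * r ^ n < \<epsilon>"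
    using \<open>\<epsilon> > 0\<close> by (intro order_tendstoD) simp_all
  then obtain N where N: "\<And>n. n \<ge> N \<Longrightarrow> K / (1 - r) * r ^ n < \<epsilon>"
    by (auto simp: eventually_sequentially)
  show "\<exists>N. \<forall>m\<ge>N. \<forall>n\<ge>N. hnorm H (f m \<ominus>\<^bsub>H\<^esub> f n) < \<epsilon>"
  proof (intro exI[of _ N] allI impI)
    fix m n assume "N \<le> m" "N \<le> n"
    then show "hnorm H (f m \<ominus>\<^bsub>H\<^esub> f n) < \<epsilon>"
      using bound[of n m] bound[of m n] N[of n] N[of m] hnorm_minus_commute[OF f f, of m n]
      by (cases "n \<le> m") auto
  qed
qed

text \<open>Gradient descent \<open>x \<mapsto> x - \<tau> A x\<close> for the quadratic form of \<open>A\<close>: by \<open>gap\<close> the form decays geometrically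
  along the orbit, which therefore converges, and the limit is \<open>0\<close> by \<open>ker\<close>.  Summing the losses of
  \<open>\<parallel>x\<parallel>\<^sup>2\<close> bounds it by the form, up to a factor that tends to \<open>1\<close> as \<open>\<tau>\<close> tends to \<open>0\<close>.\<close>

lemma spectral_gap:
  assumes closed: "\<And>x. x \<in> carrier H \<Longrightarrow> A x \<in> carrier H"
    and self_adjoint: "\<And>x y. \<lbrakk>x \<in> carrier H; y \<in> carrier H\<rbrakk> \<Longrightarrow> \<llangle>A x, y\<rrangle> = \<llangle>x, A y\<rrangle>"
    and pos: "\<And>x. x \<in> carrier H \<Longrightarrow> 0 \<le> \<llangle>A x, x\<rrangle>"
    and bounded: "\<And>x. x \<in> carrier H \<Longrightarrow> \<llangle>A x, x\<rrangle> \<le> C * \<llangle>x, x\<rrangle>"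
    and gap: "\<And>x. x \<in> carrier H \<Longrightarrow> \<delta> * \<llangle>A x, x\<rrangle> \<le> \<llangle>A x, A x\<rrangle>"
    and ker: "\<And>x. \<lbrakk>x \<in> carrier H; \<llangle>A x, x\<rrangle> = 0\<rbrakk> \<Longrightarrow> x = \<zero>\<^bsub>H\<^esub>"
    and \<delta>: "\<delta> > 0" and C: "C > 0" and x: "x \<in> carrier H"
  shows "\<delta> * \<llangle>x, x\<rrangle> \<le> \<llangle>A x, x\<rrangle>"
proof -
  \<comment> \<open>For a fixed step size the bound is weaker by the factor (2 - C \<tau>) / 2,
    which is removed at the end by letting \<tau> tend to 0. The conditions on \<tau> give 2 - C
    \<tau> \<ge> 1 and \<rho> \<ge> 0.\<close>
  have main: "\<delta> * (2 - C * \<tau>) * \<llangle>x, x\<rrangle> \<le> 2 * \<llangle>A x, x\<rrangle>"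
    if \<tau>: "0 < \<tau>" "\<tau> * C \<le> 1" "2 * \<tau> * \<delta> \<le> 1" for \<tau>
  proof -
    \<comment> \<open>The factor by which one step of the descent contracts the form.\<close>
    define \<rho> where "\<rho> = 1 - \<delta> * \<tau> * (2 - C * \<tau>)"
    have c: "1 \<le> 2 - C * \<tau>" "2 - C * \<tau> \<le> 2" using \<tau> C by (simp_all add: mult.commute)
    have "\<delta> * \<tau> * (2 - C * \<tau>) \<le> \<delta> * \<tau> * 2" using c \<tau> \<delta> by (intro mult_left_mono) simp_all
    moreover have "0 < \<delta> * \<tau> * (2 - C * \<tau>)" using c \<tau> \<delta> by simp
    ultimately have \<rho>: "0 \<le> \<rho>" "\<rho> < 1" using \<tau> by (simp_all add: \<rho>_def mult_ac)
    define T where "T y = y \<oplus>\<^bsub>H\<^esub> (- \<tau>) \<cdot> A y" for y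
    define u where "u n = (T ^^ n) x" for n
    have u_Suc: "u (Suc n) = T (u n)" for n by (simp add: u_def)
    have u [simp]: "u n \<in> carrier H" for n
      by (induction n) (simp_all add: u_def T_def closed x)
    have T_form: "\<llangle>A (T y), T y\<rrangle> = \<llangle>A y, y\<rrangle> - 2 * \<tau> * \<llangle>A y, A y\<rrangle> + \<tau>\<^sup>2 * \<llangle>A (A y), A y\<rrangle>"
      if "y \<in> carrier H" for y
    proof -
      have "\<llangle>A (T y), T y\<rrangle> = \<llangle>A (T y), y\<rrangle> - \<tau> * \<llangle>A (T y), A y\<rrangle>"
        using that by (simp add: T_def rip_simps closed)
      \<comment> \<open>Self-adjointness takes \<open>A\<close> off the sum \<open>T y\<close>, so
        that the inner product can be expanded.\<close>
      also have "\<llangle>A (T y), y\<rrangle> = \<llangle>T y, A y\<rrangle>" using that by (simp add: T_def closed self_adjoint)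
      also have "\<dots> = \<llangle>A y, y\<rrangle> - \<tau> * \<llangle>A y, A y\<rrangle>"
        using that by (simp add: T_def rip_simps closed self_adjoint)
      also have "\<llangle>A (T y), A y\<rrangle> = \<llangle>T y, A (A y)\<rrangle>" using that by (simp add: T_def closed self_adjoint)
      also have "\<dots> = \<llangle>A y, A y\<rrangle> - \<tau> * \<llangle>A (A y), A y\<rrangle>"
        using that by (simp add: T_def rip_simps closed self_adjoint[of y "A y"] self_adjoint[of "A y" "A y"])
      finally show ?thesis by (simp add: algebra_simps power2_eq_square)
    qed
    have T_form_le: "\<llangle>A (T y), T y\<rrangle> \<le> \<llangle>A y, y\<rrangle> - \<tau> * (2 - C * \<tau>) * \<llangle>A y, A y\<rrangle>"
      if "y \<in> carrier H" for y
    proof -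
      have "\<tau>\<^sup>2 * \<llangle>A (A y), A y\<rrangle> \<le> \<tau>\<^sup>2 * (C * \<llangle>A y, A y\<rrangle>)"
        using that by (intro mult_left_mono bounded closed) simp_all
      then show ?thesis using that by (simp add: T_form algebra_simps power2_eq_square)
    qed
    have decay: "\<llangle>A (u n), u n\<rrangle> \<le> \<rho> ^ n * \<llangle>A x, x\<rrangle>" for n
    proof (induction n)
      case 0
      then show ?case by (simp add: u_def)
    next
      case (Suc n)
      have "\<tau> * (2 - C * \<tau>) * (\<delta> * \<llangle>A (u n), u n\<rrangle>) \<le> \<tau> * (2 - C * \<tau>) * \<llangle>A (u n), A (u n)\<rrangle>"
        using \<tau> c by (intro mult_left_mono gap) simp_all
      then have "\<llangle>A (u (Suc n)), u (Suc n)\<rrangle> \<le> \<rho> * \<llangle>A (u n), u n\<rrangle>"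
        using T_form_le[of "u n"] by (simp add: u_Suc \<rho>_def algebra_simps)
      also have "\<dots> \<le> \<rho> * (\<rho> ^ n * \<llangle>A x, x\<rrangle>)" by (rule mult_left_mono[OF Suc.IH \<rho>(1)])
      finally show ?case by (simp add: mult_ac)
    qed
    have step: "hnorm H (u (Suc n) \<ominus>\<^bsub>H\<^esub> u n) \<le> sqrt (\<tau> * \<llangle>A x, x\<rrangle>) * sqrt \<rho> ^ n" for n
    proof -
      \<comment> \<open>The form is nonnegative at \<open>T (u n)\<close>, so
        \<open>T_form_le\<close> bounds the gradient by the form, which decays
        geometrically.\<close>
      have "\<tau> * \<llangle>A (u n), A (u n)\<rrangle> \<le> \<tau> * (2 - C * \<tau>) * \<llangle>A (u n), A (u n)\<rrangle>"
        using c \<tau> by (intro mult_right_mono) (simp_all add: rip_nonneg closed)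
      also have "\<dots> \<le> \<llangle>A (u n), u n\<rrangle>"
        using T_form_le[of "u n"] pos[of "T (u n)"] by (simp add: T_def closed)
      also note decay[of n]
      finally have "\<tau> * (\<tau> * \<llangle>A (u n), A (u n)\<rrangle>) \<le> \<tau> * (\<rho> ^ n * \<llangle>A x, x\<rrangle>)"
        using \<tau> by simp
      moreover have "u (Suc n) \<ominus>\<^bsub>H\<^esub> u n = (- \<tau>) \<cdot> A (u n)"
        by (simp add: u_Suc T_def a_minus_def a_ac closed r_neg1 r_neg2)
      ultimately have "(hnorm H (u (Suc n) \<ominus>\<^bsub>H\<^esub> u n))\<^sup>2 \<le> \<tau> * \<llangle>A x, x\<rrangle> * \<rho> ^ n"
        by (simp add: hnorm_power2 rip_simps closed mult_ac)
      then have "hnorm H (u (Suc n) \<ominus>\<^bsub>H\<^esub> u n) \<le> sqrt (\<tau> * \<llangle>A x, x\<rrangle> * \<rho> ^ n)"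
        by (rule real_le_rsqrt)
      then show ?thesis by (simp add: real_sqrt_mult real_sqrt_power)
    qed
    have "0 \<le> sqrt \<rho>" "sqrt \<rho> < 1" using \<rho> by simp_all
    then obtain l where l: "l \<in> carrier H" and lim: "(\<lambda>n. hnorm H (u n \<ominus>\<^bsub>H\<^esub> l)) \<longlonglongrightarrow> 0"
      using Cauchy_if_geometric[OF u step] by blast
    have form_0: "(\<lambda>n. \<rho> ^ n * \<llangle>A x, x\<rrangle>) \<longlonglongrightarrow> 0"
      using \<rho> by (intro tendsto_mult_left_zero LIMSEQ_power_zero) simp
    have "\<llangle>A l, l\<rrangle> \<le> 2 * (C * (hnorm H (u n \<ominus>\<^bsub>H\<^esub> l))\<^sup>2) + 2 * (\<rho> ^ n * \<llangle>A x, x\<rrangle>)" for n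
    proof -
      have exp: "\<llangle>A (a \<cdot> u n \<oplus>\<^bsub>H\<^esub> (- 1) \<cdot> l), a \<cdot> u n \<oplus>\<^bsub>H\<^esub> (- 1) \<cdot> l\<rrangle>
          = a\<^sup>2 * \<llangle>A (u n), u n\<rrangle> - 2 * a * \<llangle>A (u n), l\<rrangle> + \<llangle>A l, l\<rrangle>" for a
      proof -
        let ?y = "a \<cdot> u n \<oplus>\<^bsub>H\<^esub> (- 1) \<cdot> l"
        have y: "?y \<in> carrier H" using l by simp
        have *: "\<llangle>A ?y, z\<rrangle> = a * \<llangle>A (u n), z\<rrangle> - \<llangle>A l, z\<rrangle>" if "z \<in> carrier H" for z
          using l that by (simp add: self_adjoint[OF y that] rip_simps closed self_adjoint)
        have "\<llangle>A ?y, ?y\<rrangle> = a * \<llangle>A ?y, u n\<rrangle> - \<llangle>A ?y, l\<rrangle>"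
          using l y by (simp add: rip_simps closed)
        then show ?thesis
          using l *[of "u n"] *[of l] self_adjoint[of l "u n"] rip_commute[of l "A (u n)"]
          by (simp add: closed algebra_simps power2_eq_square)
      qed
      have "\<llangle>A l, l\<rrangle> \<le> 2 * \<llangle>A (1 \<cdot> u n \<oplus>\<^bsub>H\<^esub> (- 1) \<cdot> l), 1 \<cdot> u n \<oplus>\<^bsub>H\<^esub> (- 1) \<cdot> l\<rrangle> + 2 * \<llangle>A (u n), u n\<rrangle>"
        using pos[of "2 \<cdot> u n \<oplus>\<^bsub>H\<^esub> (- 1) \<cdot> l"] l unfolding exp by simp
      also have "\<dots> \<le> 2 * (C * \<llangle>1 \<cdot> u n \<oplus>\<^bsub>H\<^esub> (- 1) \<cdot> l, 1 \<cdot> u n \<oplus>\<^bsub>H\<^esub> (- 1) \<cdot> l\<rrangle>) + 2 * (\<rho> ^ n * \<llangle>A x, x\<rrangle>)"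
        using bounded[of "1 \<cdot> u n \<oplus>\<^bsub>H\<^esub> (- 1) \<cdot> l"] decay[of n] l by simp
      also have "1 \<cdot> u n = u n"
        using smult_one[OF u] by (simp add: rscale_def complex_ring_def)
      finally show ?thesis using l by (simp add: hnorm_power2 minus_eq_rscale)
    qed
    moreover have "(\<lambda>n. 2 * (C * (hnorm H (u n \<ominus>\<^bsub>H\<^esub> l))\<^sup>2) + 2 * (\<rho> ^ n * \<llangle>A x, x\<rrangle>)) \<longlonglongrightarrow> 2 * (C * 0\<^sup>2) + 2 * 0"
      by (intro tendsto_intros lim form_0)
    ultimately have "\<llangle>A l, l\<rrangle> \<le> 2 * (C * 0\<^sup>2) + 2 * 0" by (intro LIMSEQ_le_const) auto
    then have "l = \<zero>\<^bsub>H\<^esub>" using ker[OF l] pos[OF l] by simp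
    moreover have "u n \<ominus>\<^bsub>H\<^esub> \<zero>\<^bsub>H\<^esub> = u n" for n
      by (simp add: a_minus_def)
    ultimately have lim0: "(\<lambda>n. hnorm H (u n)) \<longlonglongrightarrow> 0" using lim by simp
    \<comment> \<open>A step loses at most 2 \<tau> times the form from the squared norm; the losses
      are summed up.\<close>
    have loss: "\<llangle>x, x\<rrangle> \<le> \<llangle>u n, u n\<rrangle> + 2 * \<tau> * (\<Sum>k<n. \<llangle>A (u k), u k\<rrangle>)" for n
    proof (induction n)
      case 0
      then show ?case by (simp add: u_def)
    next
      case (Suc n)
      have "\<llangle>u (Suc n), u (Suc n)\<rrangle> = \<llangle>u n, u n\<rrangle> - 2 * \<tau> * \<llangle>A (u n), u n\<rrangle> + \<tau>\<^sup>2 * \<llangle>A (u n), A (u n)\<rrangle>"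
        by (simp add: u_Suc T_def rip_simps closed self_adjoint algebra_simps power2_eq_square)
      moreover have "0 \<le> \<tau>\<^sup>2 * \<llangle>A (u n), A (u n)\<rrangle>" by (simp add: rip_nonneg closed)
      ultimately show ?case using Suc.IH by (simp add: algebra_simps)
    qed
    have "\<llangle>x, x\<rrangle> \<le> (hnorm H (u n))\<^sup>2 + 2 * \<tau> * (\<llangle>A x, x\<rrangle> / (1 - \<rho>))" for n
    proof -
      have "(\<Sum>k<n. \<llangle>A (u k), u k\<rrangle>) \<le> (\<Sum>k<n. \<rho> ^ k * \<llangle>A x, x\<rrangle>)" by (intro sum_mono decay)
      also have "\<dots> = (\<Sum>k<n. \<rho> ^ k) * \<llangle>A x, x\<rrangle>" by (simp add: sum_distrib_right)
      also have "\<dots> \<le> 1 / (1 - \<rho>) * \<llangle>A x, x\<rrangle>"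
        using \<rho> by (intro mult_right_mono pos x geometric_sum_le) simp_all
      finally have "2 * \<tau> * (\<Sum>k<n. \<llangle>A (u k), u k\<rrangle>) \<le> 2 * \<tau> * (\<llangle>A x, x\<rrangle> / (1 - \<rho>))"
        using \<tau> by (intro mult_left_mono) simp_all
      then show ?thesis using loss[of n] by (simp add: hnorm_power2)
    qed
    moreover have "(\<lambda>n. (hnorm H (u n))\<^sup>2 + 2 * \<tau> * (\<llangle>A x, x\<rrangle> / (1 - \<rho>)))
        \<longlonglongrightarrow> 0\<^sup>2 + 2 * \<tau> * (\<llangle>A x, x\<rrangle> / (1 - \<rho>))"
      by (intro tendsto_intros lim0)
    ultimately have "\<llangle>x, x\<rrangle> \<le> 0\<^sup>2 + 2 * \<tau> * (\<llangle>A x, x\<rrangle> / (1 - \<rho>))"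
      by (intro LIMSEQ_le_const) auto
    \<comment> \<open>Since 1 - \<rho> = \<delta> \<tau> (2 - C \<tau>), a factor \<tau>
      cancels.\<close>
    then have "\<llangle>x, x\<rrangle> * (1 - \<rho>) \<le> 2 * \<tau> * \<llangle>A x, x\<rrangle>" using \<rho> by (simp add: field_simps)
    then have "\<tau> * (\<delta> * (2 - C * \<tau>) * \<llangle>x, x\<rrangle>) \<le> \<tau> * (2 * \<llangle>A x, x\<rrangle>)"
      by (simp add: \<rho>_def algebra_simps)
    then show ?thesis using \<tau> by (simp only: mult_le_cancel_left_pos)
  qed
  have "((\<lambda>\<tau>. \<delta> * (2 - C * \<tau>) * \<llangle>x, x\<rrangle>) \<longlongrightarrow> \<delta> * (2 - C * 0) * \<llangle>x, x\<rrangle>) (at_right 0)"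
    by (intro tendsto_intros)
  moreover have "\<forall>\<^sub>F \<tau> in at_right 0. \<delta> * (2 - C * \<tau>) * \<llangle>x, x\<rrangle> \<le> 2 * \<llangle>A x, x\<rrangle>"
    unfolding eventually_at_right_field
  proof (intro exI[of _ "min (1 / C) (1 / (2 * \<delta>))"] conjI allI impI)
    fix \<tau> assume "0 < \<tau>" "\<tau> < min (1 / C) (1 / (2 * \<delta>))"
    then show "\<delta> * (2 - C * \<tau>) * \<llangle>x, x\<rrangle> \<le> 2 * \<llangle>A x, x\<rrangle>"
      using C \<delta> by (intro main) (simp_all add: field_simps)
  qed (use C \<delta> in simp)
  ultimately have "\<delta> * (2 - C * 0) * \<llangle>x, x\<rrangle> \<le> 2 * \<llangle>A x, x\<rrangle>"
    by (rule tendsto_upperbound) simp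
  then show ?thesis by simp
qed

end

section \<open>Letters as elements of the Steinberg group\<close>

definition (in group) signed :: "bool \<Rightarrow> 'a \<Rightarrow> 'a" where
  "signed b x = (if b then x else inv x)"

section \<open>Heisenberg relations between signed generators\<close>

context group
begin

lemma signed_closed [simp]: "x \<in> carrier G \<Longrightarrow> signed b x \<in> carrier G"
  by (simp add: signed_def)

lemma inv_signed: "x \<in> carrier G \<Longrightarrow> inv (signed b x) = signed (\<not> b) x"
  by (simp add: signed_def)

lemma commute_inv:
  assumes "x \<in> carrier G" "y \<in> carrier G" "x \<otimes> y = y \<otimes> x"
  shows "x \<otimes> inv y = inv y \<otimes> x"
proof -
  have "inv y \<otimes> (x \<otimes> y) \<otimes> inv y = inv y \<otimes> (y \<otimes> x) \<otimes> inv y" by (simp only: assms(3))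
  then show ?thesis using assms(1,2) by (simp add: m_assoc inv_solve_left)
qed

lemma central_commutator_inv_right:
  assumes x: "x \<in> carrier G" and y: "y \<in> carrier G" and z: "z \<in> carrier G"
    and xy: "x \<otimes> y = z \<otimes> y \<otimes> x" and zy: "z \<otimes> y = y \<otimes> z"
  shows "x \<otimes> inv y = inv z \<otimes> inv y \<otimes> x"
proof -
  have "x = (x \<otimes> y) \<otimes> inv y" using x y by (simp add: m_assoc)
  also have "\<dots> = y \<otimes> (z \<otimes> (x \<otimes> inv y))" unfolding xy zy using x y z by (simp add: m_assoc)
  finally have "inv z \<otimes> (inv y \<otimes> x) = inv z \<otimes> (inv y \<otimes> (y \<otimes> (z \<otimes> (x \<otimes> inv y))))" by simp
  then show ?thesis using x y z by (simp add: m_assoc[symmetric])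
qed

lemma central_commutator_inv_left:
  assumes x: "x \<in> carrier G" and y: "y \<in> carrier G" and z: "z \<in> carrier G"
    and xy: "x \<otimes> y = z \<otimes> y \<otimes> x" and zx: "z \<otimes> x = x \<otimes> z"
  shows "inv x \<otimes> y = inv z \<otimes> y \<otimes> inv x"
proof -
  have "y = inv x \<otimes> (x \<otimes> y)" using x y by (simp add: m_assoc[symmetric])
  also have "\<dots> = (inv x \<otimes> z) \<otimes> (y \<otimes> x)" unfolding xy using x y z by (simp add: m_assoc)
  also have "inv x \<otimes> z = z \<otimes> inv x" using commute_inv[OF z x zx] by simp
  finally have "inv z \<otimes> y \<otimes> inv x = inv z \<otimes> ((z \<otimes> inv x) \<otimes> (y \<otimes> x)) \<otimes> inv x" by simp
  also have "\<dots> = (inv z \<otimes> z) \<otimes> (inv x \<otimes> y) \<otimes> (x \<otimes> inv x)"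
    using x y z by (simp only: m_assoc m_closed inv_closed)
  finally show ?thesis using x y z by simp
qed

text \<open>Here z = [x, y] commutes with x and y, so inverting x or y inverts the commutator: its
  exponent is the product of the two signs. The second form is the relation for [y, x] =
  z^-1.\<close>

lemma central_commutator_signed:
  assumes x: "x \<in> carrier G" and y: "y \<in> carrier G" and z: "z \<in> carrier G"
    and xy: "x \<otimes> y = z \<otimes> y \<otimes> x" and zx: "z \<otimes> x = x \<otimes> z" and zy: "z \<otimes> y = y \<otimes> z"
  shows "signed b x \<otimes> signed c y = signed (b = c) z \<otimes> signed c y \<otimes> signed b x"
    and "signed c y \<otimes> signed b x = signed (b \<noteq> c) z \<otimes> signed b x \<otimes> signed c y"
proof -
  show 1: "signed b x \<otimes> signed c y = signed (b = c) z \<otimes> signed c y \<otimes> signed b x" for b c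
  proof -
    have "inv z \<otimes> x = x \<otimes> inv z" using commute_inv[OF x z zx[symmetric]] by simp
    then have "inv x \<otimes> inv y = inv (inv z) \<otimes> inv y \<otimes> inv x"
      by (intro central_commutator_inv_left central_commutator_inv_right x y z xy zy inv_closed)
    moreover have "x \<otimes> inv y = inv z \<otimes> inv y \<otimes> x"
      by (intro central_commutator_inv_right x y z xy zy)
    moreover have "inv x \<otimes> y = inv z \<otimes> y \<otimes> inv x"
      by (intro central_commutator_inv_left x y z xy zx)
    ultimately show ?thesis using xy z by (cases b; cases c) (simp_all add: signed_def)
  qed
  have "signed (b \<noteq> c) z \<otimes> signed b x \<otimes> signed c y
      = signed (b \<noteq> c) z \<otimes> (signed (b = c) z \<otimes> signed c y \<otimes> signed b x)"
    using x y z by (simp add: m_assoc 1)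
  also have "\<dots> = (signed (b \<noteq> c) z \<otimes> signed (b = c) z) \<otimes> (signed c y \<otimes> signed b x)"
    using x y z by (simp add: m_assoc)
  also have "signed (b \<noteq> c) z \<otimes> signed (b = c) z = \<one>" using z by (simp add: signed_def)
  finally show "signed c y \<otimes> signed b x = signed (b \<noteq> c) z \<otimes> signed b x \<otimes> signed c y"
    using x y by simp
qed

end

section \<open>Root subgroups of the Steinberg group\<close>

abbreviation St3_class :: "(nat \<times> nat) word \<Rightarrow> (nat \<times> nat) word set" where
  "St3_class w \<equiv> word_eq St3_indices St3_relations `` {w}"

abbreviation St3_gen :: "nat \<times> nat \<Rightarrow> (nat \<times> nat) word set" where
  "St3_gen \<equiv> presented_gen St3_indices St3_relations"

interpretation St3: group St3
  unfolding St3_def by (rule group_presented_group)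

lemma St3_carrier: "h \<in> carrier St3 \<longleftrightarrow> (\<exists>w\<in>words St3_indices. h = St3_class w)"
  by (auto simp: St3_def presented_group_def quotient_def)

lemma St3_mult_class: "\<lbrakk>u \<in> words St3_indices; v \<in> words St3_indices\<rbrakk> \<Longrightarrow>
    St3_class u \<otimes>\<^bsub>St3\<^esub> St3_class v = St3_class (u @ v)"
  unfolding St3_def by (rule presented_group_mult_class)

lemma St3_one: "\<one>\<^bsub>St3\<^esub> = St3_class []"
  by (simp add: St3_def presented_group_def)

lemma St3_gen_closed: "x \<in> St3_indices \<Longrightarrow> St3_gen x \<in> carrier St3"
  by (auto simp: St3_carrier presented_gen_def intro!: bexI[of _ "[(x, True)]"])

lemma St3_class_letter:
  assumes x: "x \<in> St3_indices"
  shows "St3_class [(x, b)] = St3.signed b (St3_gen x)"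
proof (cases b)
  case False
  have "([(x, False), (x, True)], []) \<in> word_eq St3_indices St3_relations"
    using word_eq.cancel[of "[]" St3_indices "[]" x False St3_relations] x by simp
  then have "St3_class [(x, False)] \<otimes>\<^bsub>St3\<^esub> St3_gen x = \<one>\<^bsub>St3\<^esub>"
    using x by (simp add: presented_gen_def St3_mult_class St3_one word_class_eq_iff)
  then have "inv\<^bsub>St3\<^esub> (St3_gen x) = St3_class [(x, False)]"
    using x by (intro St3.inv_equality St3_gen_closed) (auto simp: St3_carrier)
  then show ?thesis using False by (simp add: St3.signed_def)
qed (simp add: St3.signed_def presented_gen_def)

lemma St3_relation:
  assumes "(commutator_word x y, r) \<in> St3_relations" "r \<in> words St3_indices"
    and x: "x \<in> St3_indices" and y: "y \<in> St3_indices"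
  shows "St3_gen x \<otimes>\<^bsub>St3\<^esub> St3_gen y = St3_class r \<otimes>\<^bsub>St3\<^esub> St3_gen y \<otimes>\<^bsub>St3\<^esub> St3_gen x"
proof -
  let ?x = "St3_gen x" and ?y = "St3_gen y"
  have xy: "?x \<in> carrier St3" "?y \<in> carrier St3" using x y by (simp_all add: St3_gen_closed)
  have "(commutator_word x y, r) \<in> word_eq St3_indices St3_relations"
    using word_eq.relation[of "[]" St3_indices "[]" "commutator_word x y" r St3_relations] assms
    by (simp add: commutator_word_def)
  then have "St3_class r = St3_class (commutator_word x y)"
    using assms by (simp add: word_class_eq_iff commutator_word_def word_eq.sym)
  also have "\<dots> = St3_class [(x, True)] \<otimes>\<^bsub>St3\<^esub> (St3_class [(y, True)] \<otimes>\<^bsub>St3\<^esub>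
      (St3_class [(x, False)] \<otimes>\<^bsub>St3\<^esub> St3_class [(y, False)]))"
    using x y by (simp add: St3_mult_class commutator_word_def)
  finally have "St3_class r = ?x \<otimes>\<^bsub>St3\<^esub> (?y \<otimes>\<^bsub>St3\<^esub> (inv\<^bsub>St3\<^esub> ?x \<otimes>\<^bsub>St3\<^esub> inv\<^bsub>St3\<^esub> ?y))"
    using x y by (simp add: St3_class_letter St3.signed_def)
  then have "St3_class r \<otimes>\<^bsub>St3\<^esub> ?y \<otimes>\<^bsub>St3\<^esub> ?x = ?x \<otimes>\<^bsub>St3\<^esub> ?y \<otimes>\<^bsub>St3\<^esub> inv\<^bsub>St3\<^esub> ?x \<otimes>\<^bsub>St3\<^esub> (inv\<^bsub>St3\<^esub> ?y \<otimes>\<^bsub>St3\<^esub> ?y) \<otimes>\<^bsub>St3\<^esub> ?x"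
    using xy by (simp add: St3.m_assoc)
  also have "\<dots> = ?x \<otimes>\<^bsub>St3\<^esub> ?y \<otimes>\<^bsub>St3\<^esub> (inv\<^bsub>St3\<^esub> ?x \<otimes>\<^bsub>St3\<^esub> ?x)"
    using xy by (simp only: St3.l_inv St3.r_one St3.m_assoc St3.m_closed St3.inv_closed)
  finally show ?thesis using xy by simp
qed

lemma St3_commutator:
  assumes "(i, j) \<in> St3_indices" "(j, k) \<in> St3_indices" "i \<noteq> k"
  shows "St3_gen (i, j) \<otimes>\<^bsub>St3\<^esub> St3_gen (j, k)
    = St3_gen (i, k) \<otimes>\<^bsub>St3\<^esub> St3_gen (j, k) \<otimes>\<^bsub>St3\<^esub> St3_gen (i, j)"
proof -
  have ik: "(i, k) \<in> St3_indices" using assms by (auto simp: St3_indices_def)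
  have "(commutator_word (i, j) (j, k), [((i, k), True)]) \<in> St3_relations"
    using assms unfolding St3_relations_def by blast
  from St3_relation[OF this] assms ik show ?thesis by (simp add: presented_gen_def)
qed

lemma St3_commute:
  assumes "(i, j) \<in> St3_indices" "(k, l) \<in> St3_indices" "i \<noteq> l" "j \<noteq> k"
  shows "St3_gen (i, j) \<otimes>\<^bsub>St3\<^esub> St3_gen (k, l) = St3_gen (k, l) \<otimes>\<^bsub>St3\<^esub> St3_gen (i, j)"
proof -
  have "(commutator_word (i, j) (k, l), []) \<in> St3_relations"
    using assms unfolding St3_relations_def by blast
  from St3_relation[OF this] assms show ?thesis
    by (simp add: St3_one[symmetric] St3_gen_closed)
qed

fun idx_nat :: "idx \<Rightarrow> nat" where
  "idx_nat I1 = 1" | "idx_nat I2 = 2" | "idx_nat I3 = 3"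

definition root :: "idx \<Rightarrow> bool \<Rightarrow> nat \<times> nat" where
  "root k d = (if d then (idx_nat (nxt k), idx_nat (nxt (nxt k)))
    else (idx_nat (nxt (nxt k)), idx_nat (nxt k)))"

fun letter_elt :: "letter \<Rightarrow> (nat \<times> nat) word set" where
  "letter_elt (k, d, b) = St3.signed b (St3_gen (root k d))"

fun word_elt :: "letter list \<Rightarrow> (nat \<times> nat) word set" where
  "word_elt [] = \<one>\<^bsub>St3\<^esub>"
| "word_elt (a # w) = letter_elt a \<otimes>\<^bsub>St3\<^esub> word_elt w"

lemma root_in_indices: "root k d \<in> St3_indices"
  by (cases k) (simp_all add: root_def St3_indices_def)

lemma St3_indices_eq_roots: "St3_indices = (\<lambda>(k, d). root k d) ` UNIV"
proof (intro equalityI subsetI)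
  fix x assume "x \<in> St3_indices"
  then have "\<exists>k\<in>{I1, I2, I3}. \<exists>d\<in>{True, False}. x = root k d"
    by (auto simp: St3_indices_def root_def)
  then show "x \<in> (\<lambda>(k, d). root k d) ` UNIV" by auto
qed (auto simp: root_in_indices)

lemma letter_elt_closed [simp]: "letter_elt a \<in> carrier St3"
  by (cases a) (simp add: St3_gen_closed root_in_indices)

lemma letter_elt_linv: "letter_elt (linv a) = inv\<^bsub>St3\<^esub> (letter_elt a)"
  by (cases a) (simp add: St3.inv_signed St3_gen_closed root_in_indices)

lemma word_elt_closed [simp]: "word_elt w \<in> carrier St3"
  by (induction w) simp_all

lemma word_elt_append: "word_elt (u @ v) = word_elt u \<otimes>\<^bsub>St3\<^esub> word_elt v"
  by (induction u) (simp_all add: St3.m_assoc)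

lemma word_elt_winv: "word_elt (winv w) = inv\<^bsub>St3\<^esub> (word_elt w)"
  by (induction w) (simp_all add: word_elt_append letter_elt_linv St3.inv_mult_group)

text \<open>With indices modulo 3 this is [x_(k+1,k+2), x_(k+2,k)] = x_(k+1,k). The next lemma is
  the transposed relation [x_(k,k+2), x_(k+2,k+1)] = x_(k,k+1).\<close>

lemma St3_gen_commutator_True:
  "St3_gen (root k True) \<otimes>\<^bsub>St3\<^esub> St3_gen (root (nxt k) True)
    = St3_gen (root (nxt (nxt k)) False) \<otimes>\<^bsub>St3\<^esub> St3_gen (root (nxt k) True) \<otimes>\<^bsub>St3\<^esub> St3_gen (root k True)"
  using St3_commutator by (cases k) (simp_all add: root_def St3_indices_def)

lemma St3_gen_commutator_False:
  "St3_gen (root (nxt k) False) \<otimes>\<^bsub>St3\<^esub> St3_gen (root k False)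
    = St3_gen (root (nxt (nxt k)) True) \<otimes>\<^bsub>St3\<^esub> St3_gen (root k False) \<otimes>\<^bsub>St3\<^esub> St3_gen (root (nxt k) False)"
  using St3_commutator by (cases k) (simp_all add: root_def St3_indices_def)

text \<open>The two roots share their row index or their column index.\<close>

lemma St3_gen_commute:
  assumes "k \<noteq> l"
  shows "St3_gen (root k d) \<otimes>\<^bsub>St3\<^esub> St3_gen (root l (\<not> d)) = St3_gen (root l (\<not> d)) \<otimes>\<^bsub>St3\<^esub> St3_gen (root k d)"
  using St3_commute assms by (cases k; cases l; cases d) (simp_all add: root_def St3_indices_def)

text \<open>Soundness of \<open>comm_word\<close>: the letters lie in the same root subgroup, in
  commuting ones, or in two that generate a Heisenberg group.\<close>

lemma letter_elt_comm_word:
  assumes "comm_word a b = Some z"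
  shows "letter_elt a \<otimes>\<^bsub>St3\<^esub> letter_elt b = word_elt z \<otimes>\<^bsub>St3\<^esub> letter_elt b \<otimes>\<^bsub>St3\<^esub> letter_elt a"
proof -
  obtain k d s l e t where a: "a = (k, d, s)" and b: "b = (l, e, t)" by (cases a; cases b) auto
  let ?g = "\<lambda>k d. St3_gen (root k d)"
  have g [simp]: "?g k d \<in> carrier St3" for k d by (simp add: St3_gen_closed root_in_indices)
  \<comment> \<open>The Heisenberg relation with trivial commutator.\<close>
  have commuting: "St3.signed s x \<otimes>\<^bsub>St3\<^esub> St3.signed t y = St3.signed t y \<otimes>\<^bsub>St3\<^esub> St3.signed s x"
    if "x \<in> carrier St3" "y \<in> carrier St3" "x \<otimes>\<^bsub>St3\<^esub> y = y \<otimes>\<^bsub>St3\<^esub> x" for x y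
    using St3.central_commutator_signed(1)[of x y "\<one>\<^bsub>St3\<^esub>" s t] that by (simp add: St3.signed_def)
  have heis_True: "St3.signed s (?g k True) \<otimes>\<^bsub>St3\<^esub> St3.signed t (?g (nxt k) True)
      = St3.signed (s = t) (?g (nxt (nxt k)) False) \<otimes>\<^bsub>St3\<^esub> St3.signed t (?g (nxt k) True) \<otimes>\<^bsub>St3\<^esub> St3.signed s (?g k True)"
    "St3.signed t (?g (nxt k) True) \<otimes>\<^bsub>St3\<^esub> St3.signed s (?g k True)
      = St3.signed (s \<noteq> t) (?g (nxt (nxt k)) False) \<otimes>\<^bsub>St3\<^esub> St3.signed s (?g k True) \<otimes>\<^bsub>St3\<^esub> St3.signed t (?g (nxt k) True)"
    for k s t
  proof -
    have ne: "nxt (nxt k) \<noteq> k" "nxt (nxt k) \<noteq> nxt k" by (cases k; simp)+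
    note * = St3.central_commutator_signed[OF g g g St3_gen_commutator_True
        St3_gen_commute[OF ne(1), of False, simplified] St3_gen_commute[OF ne(2), of False, simplified]]
    show "St3.signed s (?g k True) \<otimes>\<^bsub>St3\<^esub> St3.signed t (?g (nxt k) True)
      = St3.signed (s = t) (?g (nxt (nxt k)) False) \<otimes>\<^bsub>St3\<^esub> St3.signed t (?g (nxt k) True) \<otimes>\<^bsub>St3\<^esub> St3.signed s (?g k True)"
      by (rule *(1))
    show "St3.signed t (?g (nxt k) True) \<otimes>\<^bsub>St3\<^esub> St3.signed s (?g k True)
      = St3.signed (s \<noteq> t) (?g (nxt (nxt k)) False) \<otimes>\<^bsub>St3\<^esub> St3.signed s (?g k True) \<otimes>\<^bsub>St3\<^esub> St3.signed t (?g (nxt k) True)"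
      by (rule *(2))
  qed
  have heis_False: "St3.signed s (?g (nxt k) False) \<otimes>\<^bsub>St3\<^esub> St3.signed t (?g k False)
      = St3.signed (s = t) (?g (nxt (nxt k)) True) \<otimes>\<^bsub>St3\<^esub> St3.signed t (?g k False) \<otimes>\<^bsub>St3\<^esub> St3.signed s (?g (nxt k) False)"
    "St3.signed t (?g k False) \<otimes>\<^bsub>St3\<^esub> St3.signed s (?g (nxt k) False)
      = St3.signed (s \<noteq> t) (?g (nxt (nxt k)) True) \<otimes>\<^bsub>St3\<^esub> St3.signed s (?g (nxt k) False) \<otimes>\<^bsub>St3\<^esub> St3.signed t (?g k False)"
    for k s t
  proof -
    have ne: "nxt (nxt k) \<noteq> k" "nxt (nxt k) \<noteq> nxt k" by (cases k; simp)+
    note * = St3.central_commutator_signed[OF g g g St3_gen_commutator_False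
        St3_gen_commute[OF ne(2), of True, simplified] St3_gen_commute[OF ne(1), of True, simplified]]
    show "St3.signed s (?g (nxt k) False) \<otimes>\<^bsub>St3\<^esub> St3.signed t (?g k False)
      = St3.signed (s = t) (?g (nxt (nxt k)) True) \<otimes>\<^bsub>St3\<^esub> St3.signed t (?g k False) \<otimes>\<^bsub>St3\<^esub> St3.signed s (?g (nxt k) False)"
      by (rule *(1))
    show "St3.signed t (?g k False) \<otimes>\<^bsub>St3\<^esub> St3.signed s (?g (nxt k) False)
      = St3.signed (s \<noteq> t) (?g (nxt (nxt k)) True) \<otimes>\<^bsub>St3\<^esub> St3.signed s (?g (nxt k) False) \<otimes>\<^bsub>St3\<^esub> St3.signed t (?g k False)"
      by (rule *(2))
  qed
  show ?thesis
  proof (cases "k = l")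
    case True
    then have "d = e" "z = []" using assms by (simp_all add: a b split: if_splits)
    then show ?thesis using True commuting[of "?g l e" "?g l e"] by (simp add: a b)
  next
    case kl: False
    show ?thesis
    proof (cases "d = e")
      case False
      then have "?g k d \<otimes>\<^bsub>St3\<^esub> ?g l e = ?g l e \<otimes>\<^bsub>St3\<^esub> ?g k d" using St3_gen_commute[OF kl, of d] by (cases e) auto
      then show ?thesis using assms False kl commuting[OF g g] by (simp add: a b)
    next
      case True
      then have z: "z = [(third k l, \<not> d, (s = t) = ((l = nxt k) = d))]" using assms kl by (simp add: a b)
      \<comment> \<open>The cyclic order of \<open>k\<close> and \<open>l\<close> decides which of
        the two factors comes first in the defining relation, hence the sign of the
        commutator.\<close>
      consider "l = nxt k" "third k l = nxt (nxt k)" | "l \<noteq> nxt k" "k = nxt l" "third k l = nxt (nxt l)"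
        using kl by (cases k; cases l) auto
      then show ?thesis
      proof cases
        case 1
        then show ?thesis using heis_True(1)[of s k t] heis_False(2)[of s k t]
          by (cases d) (auto simp: a b z True[symmetric] eq_commute[of t s])
      next
        case 2
        then show ?thesis using heis_True(2)[of s l t] heis_False(1)[of s l t]
          by (cases d) (auto simp: a b z True[symmetric] eq_commute[of t s])
      qed
    qed
  qed
qed

lemma St3_carrier_word_elt:
  assumes "h \<in> carrier St3"
  shows "\<exists>w. h = word_elt w"
proof -
  from assms obtain v where v: "v \<in> words St3_indices" "h = St3_class v" by (auto simp: St3_carrier)
  have "\<exists>w. St3_class v = word_elt w" using v(1)
  proof (induction v)
    case Nil
    then show ?case using St3_one by (intro exI[of _ "[]"]) simp
  next
    case (Cons p v)
    obtain x b where p: "p = (x, b)" by fastforce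
    with Cons.prems have x: "x \<in> St3_indices" and v: "v \<in> words St3_indices" by simp_all
    from x obtain k d where kd: "x = root k d" by (auto simp: St3_indices_eq_roots)
    from Cons.IH[OF v] obtain w where w: "St3_class v = word_elt w" by blast
    have "St3_class (p # v) = St3_class [p] \<otimes>\<^bsub>St3\<^esub> St3_class v"
      using x v by (simp add: p St3_mult_class)
    then have "St3_class (p # v) = word_elt ((k, d, b) # w)"
      using x by (simp add: w p St3_class_letter kd)
    then show ?case by blast
  qed
  then show ?thesis using v by simp
qed

section \<open>Unitary representations of the Steinberg group\<close>

lemma sum_list_sum_swap: "(\<Sum>x\<leftarrow>xs. \<Sum>i\<in>I. f x i) = (\<Sum>i\<in>I. \<Sum>x\<leftarrow>xs. f x i)"
  by (induction xs) (simp_all add: sum.distrib)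

context complex_hilbert_space
begin

fun lincomb :: "(real \<times> 'a) list \<Rightarrow> 'a" where
  "lincomb [] = \<zero>\<^bsub>H\<^esub>"
| "lincomb ((c, v) # xs) = c \<cdot> v \<oplus>\<^bsub>H\<^esub> lincomb xs"

lemma lincomb_closed: "snd ` set xs \<subseteq> carrier H \<Longrightarrow> lincomb xs \<in> carrier H"
  by (induction xs rule: lincomb.induct) auto

lemma rip_lincomb: "\<lbrakk>snd ` set xs \<subseteq> carrier H; z \<in> carrier H\<rbrakk> \<Longrightarrow>
    \<llangle>lincomb xs, z\<rrangle> = (\<Sum>(c, v)\<leftarrow>xs. c * \<llangle>v, z\<rrangle>)"
  by (induction xs rule: lincomb.induct) (simp_all add: rip_zero_left rip_simps lincomb_closed)

text \<open>The double sum is the squared norm of a linear combination of the vectors.\<close>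

lemma gram_nonneg:
  assumes "\<And>x. x \<in> set xs \<Longrightarrow> v x \<in> carrier H"
  shows "0 \<le> (\<Sum>x\<leftarrow>xs. \<Sum>y\<leftarrow>xs. c x * c y * \<llangle>v y, v x\<rrangle>)"
proof -
  let ?l = "map (\<lambda>x. (c x, v x)) xs"
  have l: "snd ` set ?l \<subseteq> carrier H" using assms by auto
  have "\<llangle>lincomb ?l, z\<rrangle> = (\<Sum>x\<leftarrow>xs. c x * \<llangle>v x, z\<rrangle>)" if "z \<in> carrier H" for z
    using rip_lincomb[OF l that] by (simp add: o_def)
  then have "\<llangle>lincomb ?l, lincomb ?l\<rrangle> = (\<Sum>x\<leftarrow>xs. c x * \<llangle>v x, lincomb ?l\<rrangle>)"
    and *: "z \<in> carrier H \<Longrightarrow> \<llangle>z, lincomb ?l\<rrangle> = (\<Sum>y\<leftarrow>xs. c y * \<llangle>v y, z\<rrangle>)" for z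
    using l by (simp_all add: lincomb_closed rip_commute[of z])
  then have "\<llangle>lincomb ?l, lincomb ?l\<rrangle> = (\<Sum>x\<leftarrow>xs. c x * (\<Sum>y\<leftarrow>xs. c y * \<llangle>v y, v x\<rrangle>))"
    using assms by (simp cong: map_cong)
  then show ?thesis
    using rip_nonneg[OF lincomb_closed[OF l]] by (simp add: sum_list_const_mult mult.assoc)
qed

end

context unitary_rep
begin

lemma rep_closed [simp]: "\<lbrakk>g \<in> carrier G; x \<in> carrier H\<rbrakk> \<Longrightarrow> \<pi> g x \<in> carrier H"
  using element_image by blast

lemma rip_rep: "\<lbrakk>g \<in> carrier G; x \<in> carrier H; y \<in> carrier H\<rbrakk> \<Longrightarrow> \<llangle>\<pi> g x, \<pi> g y\<rrangle> = \<llangle>x, y\<rrangle>"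
  by (simp add: real_inner_prod_def rep_inner)

lemma G_group: "group G"
  using group_hom by (simp add: group_hom_def)

lemma rip_rep_inv_mult:
  assumes g: "g \<in> carrier G" and h: "h \<in> carrier G" and x: "x \<in> carrier H" and y: "y \<in> carrier H"
  shows "\<llangle>\<pi> (inv g \<otimes> h) x, y\<rrangle> = \<llangle>\<pi> h x, \<pi> g y\<rrangle>"
proof -
  interpret G: group G by (rule G_group)
  have "\<llangle>\<pi> (inv g \<otimes> h) x, y\<rrangle> = \<llangle>\<pi> g (\<pi> (inv g \<otimes> h) x), \<pi> g y\<rrangle>"
    using assms by (simp add: rip_rep)
  also have "\<pi> g (\<pi> (inv g \<otimes> h) x) = \<pi> (g \<otimes> (inv g \<otimes> h)) x"
    using assms composition_rule[of x g "inv g \<otimes> h"] by simp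
  also have "g \<otimes> (inv g \<otimes> h) = h"
    using g h by (simp add: G.m_assoc[symmetric])
  finally show ?thesis .
qed

text \<open>Half the squared norm of \<pi>(g) \<xi> - \<xi>, written as a constant minus a matrix
  coefficient, from which the negative type is visible.\<close>

definition displacement where
  "displacement \<xi> g = \<llangle>\<xi>, \<xi>\<rrangle> - \<llangle>\<pi> g \<xi>, \<xi>\<rrangle>"

lemma displacement_eq:
  assumes "g \<in> carrier G" "\<xi> \<in> carrier H"
  shows "(hnorm H (\<pi> g \<xi> \<ominus>\<^bsub>H\<^esub> \<xi>))\<^sup>2 = 2 * displacement \<xi> g"
  using assms by (simp add: hnorm_power2 minus_eq_rscale rip_simps rip_rep displacement_def
      rip_commute[of \<xi> "\<pi> g \<xi>"])

lemma displacement_nonneg: "\<lbrakk>g \<in> carrier G; \<xi> \<in> carrier H\<rbrakk> \<Longrightarrow> 0 \<le> displacement \<xi> g"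
  using displacement_eq[of g \<xi>] zero_le_power2[of "hnorm H (\<pi> g \<xi> \<ominus>\<^bsub>H\<^esub> \<xi>)"] by simp

lemma displacement_le:
  assumes g: "g \<in> carrier G" and x: "\<xi> \<in> carrier H"
  shows "displacement \<xi> g \<le> 2 * \<llangle>\<xi>, \<xi>\<rrangle>"
proof -
  have "0 \<le> \<llangle>\<pi> g \<xi> \<oplus>\<^bsub>H\<^esub> \<xi>, \<pi> g \<xi> \<oplus>\<^bsub>H\<^esub> \<xi>\<rrangle>" using g x by (intro rip_nonneg) simp
  then show ?thesis
    using g x by (simp add: rip_simps rip_rep displacement_def rip_commute[of \<xi> "\<pi> g \<xi>"])
qed

lemma displacement_one: "\<xi> \<in> carrier H \<Longrightarrow> displacement \<xi> \<one> = 0"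
  using id_eq_one by (simp add: displacement_def) (metis restrict_apply')

lemma displacement_inv_mult:
  "\<lbrakk>g \<in> carrier G; h \<in> carrier G; \<xi> \<in> carrier H\<rbrakk> \<Longrightarrow>
    displacement \<xi> (inv g \<otimes> h) = \<llangle>\<xi>, \<xi>\<rrangle> - \<llangle>\<pi> h \<xi>, \<pi> g \<xi>\<rrangle>"
  by (simp add: displacement_def rip_rep_inv_mult)

lemma displacement_inv:
  assumes "g \<in> carrier G" "\<xi> \<in> carrier H"
  shows "displacement \<xi> (inv g) = displacement \<xi> g"
proof -
  interpret G: group G by (rule G_group)
  have "\<pi> \<one> \<xi> = \<xi>" using assms id_eq_one by (metis restrict_apply')
  then show ?thesis
    using displacement_inv_mult[of g \<one> \<xi>] assms
    by (simp add: displacement_def rip_commute[of \<xi> "\<pi> g \<xi>"])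
qed

end

locale St3_rep = unitary_rep St3 H \<pi> for H (structure) and \<pi>
begin

text \<open>Averaging over all letter automorphisms gives a function on words that is constant on their orbits.\<close>

definition avg_displacement where
  "avg_displacement \<xi> w = (\<Sum>g | letter_aut g. displacement \<xi> (word_elt (map g w)))"

text \<open>For negative type, coefficients with sum 0 annihilate the constant in
  \<open>displacement\<close> and leave minus a Gram sum. Invariance under a letter automorphism is
  a reindexing of the average.\<close>

lemma length_like_avg_displacement:
  assumes \<xi>: "\<xi> \<in> carrier H"
  shows "length_like (avg_displacement \<xi>)"
proof
  show "0 \<le> avg_displacement \<xi> w" for w
    unfolding avg_displacement_def by (intro sum_nonneg displacement_nonneg \<xi>) simp
  show "avg_displacement \<xi> [] = 0"
    by (simp add: avg_displacement_def displacement_one \<xi>)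
  show "avg_displacement \<xi> (winv w) = avg_displacement \<xi> w" for w
    unfolding avg_displacement_def
    by (intro sum.cong) (simp_all add: map_winv word_elt_winv displacement_inv \<xi>)
  show "avg_displacement \<xi> (u @ a # linv a # v) = avg_displacement \<xi> (u @ v)" for u a v
    unfolding avg_displacement_def
    by (intro sum.cong) (simp_all add: word_elt_append letter_autD letter_elt_linv St3.m_assoc[symmetric])
  show "avg_displacement \<xi> (u @ a # b # v) = avg_displacement \<xi> (u @ z @ b # a # v)"
    if "comm_word a b = Some z" for a b z u v
    unfolding avg_displacement_def
  proof (intro sum.cong HOL.refl arg_cong[of _ _ "displacement \<xi>"])
    fix g assume "g \<in> {g. letter_aut g}"
    then have "comm_word (g a) (g b) = Some (map g z)" using that letter_autD(3)[of g a b] by simp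
    then have "letter_elt (g a) \<otimes>\<^bsub>St3\<^esub> letter_elt (g b)
        = word_elt (map g z) \<otimes>\<^bsub>St3\<^esub> letter_elt (g b) \<otimes>\<^bsub>St3\<^esub> letter_elt (g a)"
      by (rule letter_elt_comm_word)
    then have "letter_elt (g a) \<otimes>\<^bsub>St3\<^esub> (letter_elt (g b) \<otimes>\<^bsub>St3\<^esub> h)
        = word_elt (map g z) \<otimes>\<^bsub>St3\<^esub> (letter_elt (g b) \<otimes>\<^bsub>St3\<^esub> (letter_elt (g a) \<otimes>\<^bsub>St3\<^esub> h))"
      if "h \<in> carrier St3" for h
      using that by (simp add: St3.m_assoc[symmetric])
    then show "word_elt (map g (u @ a # b # v)) = word_elt (map g (u @ z @ b # a # v))"
      by (simp add: word_elt_append)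
  qed
  show "avg_displacement \<xi> (map h w) = avg_displacement \<xi> w" if h: "letter_aut h" for h w
  proof -
    have "surj h" using letter_autD(1)[OF h] by (rule bij_is_surj)
    then have "g = g'" if "g \<circ> h = g' \<circ> h" for g g' :: "letter \<Rightarrow> letter"
      using that by (metis comp_assoc comp_id surj_iff)
    then have "inj_on (\<lambda>g. g \<circ> h) {g. letter_aut g}"
      by (rule inj_onI)
    moreover have "(\<lambda>g. g \<circ> h) ` {g. letter_aut g} \<subseteq> {g. letter_aut g}"
      using letter_aut_comp h by auto
    \<comment> \<open>An injective self-map of a finite set is onto.\<close>
    ultimately have "bij_betw (\<lambda>g. g \<circ> h) {g. letter_aut g} {g. letter_aut g}"
      by (simp add: bij_betw_def endo_inj_surj)
    from sum.reindex_bij_betw[OF this, of "\<lambda>g. displacement \<xi> (word_elt (map g w))"]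
    show ?thesis by (simp add: avg_displacement_def)
  qed
  show "(\<Sum>x\<leftarrow>xs. \<Sum>y\<leftarrow>xs. fst x * fst y * avg_displacement \<xi> (winv (snd x) @ snd y)) \<le> 0"
    if sum0: "(\<Sum>x\<leftarrow>xs. fst x) = 0" for xs :: "(real \<times> letter list) list"
  proof -
    have "(\<Sum>x\<leftarrow>xs. \<Sum>y\<leftarrow>xs. fst x * fst y * displacement \<xi> (word_elt (map g (winv (snd x) @ snd y)))) \<le> 0"
      if g: "letter_aut g" for g
    proof -
      let ?v = "\<lambda>x. \<pi> (word_elt (map g (snd x))) \<xi>"
      have "displacement \<xi> (word_elt (map g (winv u @ v)))
          = \<llangle>\<xi>, \<xi>\<rrangle> - \<llangle>\<pi> (word_elt (map g v)) \<xi>, \<pi> (word_elt (map g u)) \<xi>\<rrangle>" for u v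
        by (simp add: map_winv[OF g] word_elt_append word_elt_winv displacement_inv_mult \<xi>)
      then have "(\<Sum>x\<leftarrow>xs. \<Sum>y\<leftarrow>xs. fst x * fst y * displacement \<xi> (word_elt (map g (winv (snd x) @ snd y))))
          = (\<Sum>x\<leftarrow>xs. \<Sum>y\<leftarrow>xs. fst x * fst y * \<llangle>\<xi>, \<xi>\<rrangle>) - (\<Sum>x\<leftarrow>xs. \<Sum>y\<leftarrow>xs. fst x * fst y * \<llangle>?v y, ?v x\<rrangle>)"
        by (simp add: right_diff_distrib sum_list_subtractf)
      moreover have "(\<Sum>x\<leftarrow>xs. \<Sum>y\<leftarrow>xs. fst x * fst y * \<llangle>\<xi>, \<xi>\<rrangle>)
          = (\<Sum>x\<leftarrow>xs. fst x) * (\<Sum>y\<leftarrow>xs. fst y) * \<llangle>\<xi>, \<xi>\<rrangle>"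
        by (simp add: sum_list_const_mult sum_list_mult_const)
      moreover have "0 \<le> (\<Sum>x\<leftarrow>xs. \<Sum>y\<leftarrow>xs. fst x * fst y * \<llangle>?v y, ?v x\<rrangle>)"
        by (rule gram_nonneg) (simp add: \<xi>)
      ultimately show ?thesis using sum0 by simp
    qed
    then have "(\<Sum>g | letter_aut g. \<Sum>x\<leftarrow>xs. \<Sum>y\<leftarrow>xs.
        fst x * fst y * displacement \<xi> (word_elt (map g (winv (snd x) @ snd y)))) \<le> 0"
      by (intro sum_nonpos) simp
    then show ?thesis
      by (simp only: avg_displacement_def sum_distrib_left sum_list_sum_swap)
  qed
qed

definition energy where
  "energy \<xi> = (\<Sum>a\<in>UNIV. displacement \<xi> (letter_elt a))"

lemma sum_UNIV_letter_aut: "letter_aut g \<Longrightarrow> (\<Sum>a\<in>UNIV. f (g a)) = (\<Sum>a\<in>UNIV. f a)"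
  using sum.reindex_bij_betw[of g UNIV UNIV f] letter_autD(1) by blast

text \<open>Sums over all letters, or over all pairs, do not change under a letter automorphism, so
  averaging multiplies them by the number of automorphisms. After averaging all letters contribute
  equally, by transitivity, and the certificate at one letter suffices.\<close>

lemma sum_displacement_mult_le:
  assumes \<xi>: "\<xi> \<in> carrier H"
  shows "(\<Sum>a\<in>UNIV. \<Sum>b\<in>UNIV. displacement \<xi> (letter_elt a \<otimes>\<^bsub>St3\<^esub> letter_elt b)) \<le> (24 - 0.175504) * energy \<xi>"
proof -
  interpret length_like "avg_displacement \<xi>" by (rule length_like_avg_displacement[OF \<xi>])
  let ?D = "avg_displacement \<xi>" and ?N = "real (card {g. letter_aut g})" and ?x = "(I3, True, True)"
  have one: "(\<Sum>a\<in>UNIV. ?D [a]) = ?N * energy \<xi>"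
  proof -
    have "(\<Sum>a\<in>UNIV. ?D [a]) = (\<Sum>g | letter_aut g. \<Sum>a\<in>UNIV. displacement \<xi> (letter_elt (g a)))"
      unfolding avg_displacement_def by (subst sum.swap) simp
    then show ?thesis
      by (simp add: energy_def sum_UNIV_letter_aut[where f = "\<lambda>a. displacement \<xi> (letter_elt a)"])
  qed
  have two: "(\<Sum>a\<in>UNIV. \<Sum>b\<in>UNIV. ?D [a, b])
      = ?N * (\<Sum>a\<in>UNIV. \<Sum>b\<in>UNIV. displacement \<xi> (letter_elt a \<otimes>\<^bsub>St3\<^esub> letter_elt b))"
  proof -
    have "(\<Sum>a\<in>UNIV. \<Sum>b\<in>UNIV. ?D [a, b]) = (\<Sum>g | letter_aut g. \<Sum>a\<in>UNIV. \<Sum>b\<in>UNIV.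
        displacement \<xi> (letter_elt (g a) \<otimes>\<^bsub>St3\<^esub> letter_elt (g b)))"
      unfolding avg_displacement_def
      by (simp add: sum.swap[where A = UNIV and B = "{g. letter_aut g}"])
    also have "\<dots> = (\<Sum>g | letter_aut g. \<Sum>a\<in>UNIV. \<Sum>b\<in>UNIV.
        displacement \<xi> (letter_elt a \<otimes>\<^bsub>St3\<^esub> letter_elt b))"
    proof (rule sum.cong[OF HOL.refl])
      fix g assume "g \<in> {g. letter_aut g}"
      then have g: "letter_aut g" by simp
      show "(\<Sum>a\<in>UNIV. \<Sum>b\<in>UNIV. displacement \<xi> (letter_elt (g a) \<otimes>\<^bsub>St3\<^esub> letter_elt (g b)))
          = (\<Sum>a\<in>UNIV. \<Sum>b\<in>UNIV. displacement \<xi> (letter_elt a \<otimes>\<^bsub>St3\<^esub> letter_elt b))"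
        using sum_UNIV_letter_aut[OF g, of "\<lambda>a. \<Sum>b\<in>UNIV. displacement \<xi> (letter_elt a \<otimes>\<^bsub>St3\<^esub> letter_elt b)"]
          sum_UNIV_letter_aut[OF g, of "\<lambda>b. displacement \<xi> (letter_elt (g a) \<otimes>\<^bsub>St3\<^esub> letter_elt b)" for a]
        by simp
    qed
    finally show ?thesis by simp
  qed
  have eq: "?D [a] = ?D [?x]" "(\<Sum>b\<in>UNIV. ?D [a, b]) = (\<Sum>b\<in>UNIV. ?D [?x, b])" for a
  proof -
    obtain g where g: "letter_aut g" "g a = ?x" using letter_aut_transitive by blast
    show "?D [a] = ?D [?x]" using aut[OF g(1), of "[a]"] g(2) by simp
    have "(\<Sum>b\<in>UNIV. ?D [a, b]) = (\<Sum>b\<in>UNIV. ?D [?x, g b])"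
      using aut[OF g(1), of "[a, b]" for b] g(2) by simp
    then show "(\<Sum>b\<in>UNIV. ?D [a, b]) = (\<Sum>b\<in>UNIV. ?D [?x, b])"
      using sum_UNIV_letter_aut[OF g(1), of "\<lambda>b. ?D [?x, b]"] by simp
  qed
  have "(\<Sum>a\<in>UNIV. ?D [a]) = (\<Sum>a\<in>(UNIV :: letter set). ?D [?x])"
    by (rule sum.cong[OF HOL.refl]) (rule eq(1))
  moreover have "(\<Sum>a\<in>UNIV. \<Sum>b\<in>UNIV. ?D [a, b]) = (\<Sum>a\<in>(UNIV :: letter set). \<Sum>b\<in>UNIV. ?D [?x, b])"
    by (rule sum.cong[OF HOL.refl]) (rule eq(2))
  ultimately have "(\<Sum>a\<in>UNIV. \<Sum>b\<in>UNIV. ?D [a, b]) \<le> (24 - 0.175504) * (\<Sum>a\<in>UNIV. ?D [a])"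
    using sum_two_letters_le by simp
  then have "?N * (\<Sum>a\<in>UNIV. \<Sum>b\<in>UNIV. displacement \<xi> (letter_elt a \<otimes>\<^bsub>St3\<^esub> letter_elt b))
      \<le> ?N * ((24 - 0.175504) * energy \<xi>)"
    unfolding one two by (simp only: mult.left_commute)
  moreover have "?N > 0"
    using letter_aut_id by (auto simp: card_gt_0_iff)
  ultimately show ?thesis by (simp only: mult_le_cancel_left_pos)
qed

section \<open>The Laplacian and its spectral gap\<close>

definition letters :: "letter list" where
  "letters = [(k, d, b). k \<leftarrow> [I1, I2, I3], d \<leftarrow> [True, False], b \<leftarrow> [True, False]]"

definition laplacian where
  "laplacian x = lincomb ((12, x) # map (\<lambda>a. (- 1, \<pi> (letter_elt a) x)) letters)"

lemma laplacian_closed [simp]: "x \<in> carrier H \<Longrightarrow> laplacian x \<in> carrier H"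
  unfolding laplacian_def by (rule lincomb_closed) (auto simp del: letter_elt.simps)

lemma rip_laplacian:
  assumes "x \<in> carrier H" "z \<in> carrier H"
  shows "\<llangle>laplacian x, z\<rrangle> = (\<Sum>a\<in>UNIV. \<llangle>x, z\<rrangle> - \<llangle>\<pi> (letter_elt a) x, z\<rrangle>)"
proof -
  have "\<llangle>laplacian x, z\<rrangle> = 12 * \<llangle>x, z\<rrangle> - (\<Sum>a\<leftarrow>letters. \<llangle>\<pi> (letter_elt a) x, z\<rrangle>)"
    unfolding laplacian_def using assms
    by (subst rip_lincomb) (auto simp: o_def uminus_sum_list_map simp del: letter_elt.simps)
  then show ?thesis by (simp add: letters_def sum_letter)
qed

lemma rip_laplacian_self: "x \<in> carrier H \<Longrightarrow> \<llangle>laplacian x, x\<rrangle> = energy x"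
  by (simp add: rip_laplacian energy_def displacement_def)

lemma sum_linv: "(\<Sum>a\<in>UNIV. f (linv a)) = (\<Sum>a\<in>UNIV. f a)"
  by (rule sum.reindex_bij_witness[of _ linv linv]) simp_all

lemma rep_inv_rip:
  assumes "g \<in> carrier St3" "x \<in> carrier H" "y \<in> carrier H"
  shows "\<llangle>\<pi> (inv\<^bsub>St3\<^esub> g) x, y\<rrangle> = \<llangle>x, \<pi> g y\<rrangle>"
  using rip_rep_inv_mult[of g "\<one>\<^bsub>St3\<^esub>" x y] assms id_eq_one by (simp add: fun_eq_iff) (metis restrict_apply')

text \<open>The set of letters is closed under inversion, and the adjoint of \<pi>(a) is
  \<pi>(a^-1).\<close>

lemma laplacian_self_adjoint:
  assumes x: "x \<in> carrier H" and y: "y \<in> carrier H"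
  shows "\<llangle>laplacian x, y\<rrangle> = \<llangle>x, laplacian y\<rrangle>"
proof -
  have "\<llangle>laplacian x, y\<rrangle> = (\<Sum>a\<in>UNIV. \<llangle>x, y\<rrangle> - \<llangle>\<pi> (letter_elt (linv a)) x, y\<rrangle>)"
    using rip_laplacian[OF x y] sum_linv[of "\<lambda>a. \<llangle>x, y\<rrangle> - \<llangle>\<pi> (letter_elt a) x, y\<rrangle>"] by simp
  also have "\<dots> = (\<Sum>a\<in>UNIV. \<llangle>y, x\<rrangle> - \<llangle>\<pi> (letter_elt a) y, x\<rrangle>)"
    using x y by (simp add: letter_elt_linv rep_inv_rip rip_commute[of x])
  also have "\<dots> = \<llangle>x, laplacian y\<rrangle>" using x y by (simp add: rip_laplacian rip_commute[of x])
  finally show ?thesis .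
qed

text \<open>Summing (1 - a)(1 - b) = (1 - a) + (1 - b) - (1 - ab) over the 144 pairs of letters
  gives \<Delta>^2 = 24 \<Delta> - \<Sum> (1 - ab).\<close>

lemma rip_laplacian_laplacian:
  assumes x: "x \<in> carrier H"
  shows "\<llangle>laplacian x, laplacian x\<rrangle>
    = 24 * energy x - (\<Sum>a\<in>UNIV. \<Sum>b\<in>UNIV. displacement x (letter_elt a \<otimes>\<^bsub>St3\<^esub> letter_elt b))"
proof -
  have inner: "\<llangle>\<pi> (letter_elt a) x, laplacian x\<rrangle>
      = (\<Sum>b\<in>UNIV. displacement x (letter_elt (linv a) \<otimes>\<^bsub>St3\<^esub> letter_elt b) - displacement x (letter_elt a))" for a
  proof -
    have "\<llangle>\<pi> (letter_elt a) x, laplacian x\<rrangle> = \<llangle>laplacian x, \<pi> (letter_elt a) x\<rrangle>"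
      using x by (simp add: rip_commute[of _ "laplacian x"])
    also have "\<dots> = (\<Sum>b\<in>UNIV. \<llangle>x, \<pi> (letter_elt a) x\<rrangle> - \<llangle>\<pi> (letter_elt b) x, \<pi> (letter_elt a) x\<rrangle>)"
      using x by (simp add: rip_laplacian)
    also have "\<dots> = (\<Sum>b\<in>UNIV. displacement x (letter_elt (linv a) \<otimes>\<^bsub>St3\<^esub> letter_elt b) - displacement x (letter_elt a))"
      using x by (simp add: letter_elt_linv displacement_inv_mult displacement_def[of x "letter_elt _"]
          rip_commute[of x "\<pi> _ x"])
    finally show ?thesis .
  qed
  have "\<llangle>laplacian x, laplacian x\<rrangle> = (\<Sum>a\<in>UNIV. \<llangle>x, laplacian x\<rrangle> - \<llangle>\<pi> (letter_elt a) x, laplacian x\<rrangle>)"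
    using x by (simp add: rip_laplacian)
  also have "\<dots> = 24 * energy x - (\<Sum>a\<in>UNIV. \<Sum>b\<in>UNIV. displacement x (letter_elt (linv a) \<otimes>\<^bsub>St3\<^esub> letter_elt b))"
    using x laplacian_self_adjoint[OF x x] rip_laplacian_self[OF x]
    by (simp add: inner sum_subtractf energy_def sum_distrib_left[symmetric])
  also have "(\<Sum>a\<in>UNIV. \<Sum>b\<in>UNIV. displacement x (letter_elt (linv a) \<otimes>\<^bsub>St3\<^esub> letter_elt b))
      = (\<Sum>a\<in>UNIV. \<Sum>b\<in>UNIV. displacement x (letter_elt a \<otimes>\<^bsub>St3\<^esub> letter_elt b))"
    by (rule sum_linv)
  finally show ?thesis .
qed

text \<open>A letter and its inverse have the same displacement, half of a squared norm, so together
  they give one full squared norm for each generator.\<close>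

lemma energy_eq: "x \<in> carrier H \<Longrightarrow>
    energy x = (\<Sum>k\<in>UNIV. \<Sum>d\<in>UNIV. (hnorm H (\<pi> (St3_gen (root k d)) x \<ominus>\<^bsub>H\<^esub> x))\<^sup>2)"
  by (simp add: energy_def sum_letter UNIV_idx UNIV_bool displacement_eq displacement_inv St3.signed_def
      St3_gen_closed root_in_indices)

text \<open>All displacements are nonnegative, so each of them vanishes and every letter fixes
  \<open>x\<close>; the letters generate the group.\<close>

lemma invariant_if_energy_0:
  assumes x: "x \<in> carrier H" and 0: "energy x = 0" and g: "g \<in> carrier St3"
  shows "\<pi> g x = x"
proof -
  have letter: "\<pi> (letter_elt a) x = x" for a
  proof -
    have "displacement x (letter_elt a) = 0"
      using sum_nonneg_0[of UNIV "\<lambda>a. displacement x (letter_elt a)" a]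
        displacement_nonneg[OF letter_elt_closed x] 0[unfolded energy_def]
      by (simp del: letter_elt.simps)
    then have "hnorm H (\<pi> (letter_elt a) x \<ominus>\<^bsub>H\<^esub> x) = 0"
      using displacement_eq[OF letter_elt_closed x, of a] by simp
    then have 0: "\<pi> (letter_elt a) x \<ominus>\<^bsub>H\<^esub> x = \<zero>\<^bsub>H\<^esub>"
      using rip_pos[of "\<pi> (letter_elt a) x \<ominus>\<^bsub>H\<^esub> x"] x by (auto simp: hnorm_eq)
    have "\<pi> (letter_elt a) x = (\<pi> (letter_elt a) x \<ominus>\<^bsub>H\<^esub> x) \<oplus>\<^bsub>H\<^esub> x"
      using x rep_closed[OF letter_elt_closed x] by (simp only: a_minus_def a_assoc a_inv_closed l_neg r_zero)
    then show ?thesis using x by (simp only: 0 l_zero)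
  qed
  obtain w where "g = word_elt w" using St3_carrier_word_elt[OF g] by blast
  moreover have "\<pi> (word_elt w) x = x"
  proof (induction w)
    case Nil
    show ?case using id_eq_one x by simp (metis restrict_apply')
  next
    case (Cons a w)
    then show ?case using composition_rule[OF x, of "letter_elt a" "word_elt w"] letter by simp
  qed
  ultimately show ?thesis by simp
qed

lemma energy_ge:
  assumes ninv: "no_invariant_vectors St3 H \<pi>" and x: "x \<in> carrier H"
  shows "0.175504 * \<llangle>x, x\<rrangle> \<le> energy x"
proof -
  have "0.175504 * \<llangle>x, x\<rrangle> \<le> \<llangle>laplacian x, x\<rrangle>"
  \<comment> \<open>Twelve letters, each with displacement at most twice the squared norm, give
    24.\<close>
  proof (rule spectral_gap[where C = 24])
    show "0 \<le> \<llangle>laplacian y, y\<rrangle>" if "y \<in> carrier H" for y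
      using that by (simp add: rip_laplacian_self energy_def displacement_nonneg sum_nonneg)
    show "\<llangle>laplacian y, y\<rrangle> \<le> 24 * \<llangle>y, y\<rrangle>" if "y \<in> carrier H" for y
    proof -
      have "energy y \<le> (\<Sum>a\<in>(UNIV :: letter set). 2 * \<llangle>y, y\<rrangle>)"
        unfolding energy_def by (intro sum_mono displacement_le that) simp
      then show ?thesis using that by (simp add: rip_laplacian_self)
    qed
    show "0.175504 * \<llangle>laplacian y, y\<rrangle> \<le> \<llangle>laplacian y, laplacian y\<rrangle>" if "y \<in> carrier H" for y
      using sum_displacement_mult_le[OF that] by (simp add: rip_laplacian_self rip_laplacian_laplacian that algebra_simps)
    show "y = \<zero>\<^bsub>H\<^esub>" if "y \<in> carrier H" "\<llangle>laplacian y, y\<rrangle> = 0" for y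
      using ninv invariant_if_energy_0[of y] that by (simp add: no_invariant_vectors_def rip_laplacian_self)
  qed (simp_all add: laplacian_self_adjoint x)
  then show ?thesis by (simp add: rip_laplacian_self x)
qed

lemma exists_gen_displacing:
  assumes ninv: "no_invariant_vectors St3 H \<pi>" and x: "x \<in> carrier H" "hnorm H x = 1"
  shows "\<exists>s\<in>St3_gens. 0.171028 \<le> hnorm H (\<pi> s x \<ominus>\<^bsub>H\<^esub> x)"
proof (rule ccontr)
  assume "\<not> ?thesis"
  then have small: "hnorm H (\<pi> (St3_gen (root k d)) x \<ominus>\<^bsub>H\<^esub> x) < 0.171028" for k d
    using root_in_indices[of k d] by (auto simp: St3_gens_def not_le)
  have "(hnorm H (\<pi> (St3_gen (root k d)) x \<ominus>\<^bsub>H\<^esub> x))\<^sup>2 \<le> 0.171028\<^sup>2" for k d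
    using small[of k d] x(1) by (intro power_mono) (simp_all add: hnorm_nonneg St3_gen_closed root_in_indices)
  then have "energy x \<le> (\<Sum>k\<in>(UNIV :: idx set). \<Sum>d\<in>(UNIV :: bool set). 0.171028\<^sup>2)"
    unfolding energy_eq[OF x(1)] by (intro sum_mono)
  \<comment> \<open>There are six generators, and 6 * 0.171028^2 = 0.17550346...\<close>
  also have "\<dots> < 0.175504" by (simp add: UNIV_idx UNIV_bool power2_eq_square)
  finally show False
    using energy_ge[OF ninv x(1)] hnorm_power2[OF x(1)] x(2) by simp
qed

end

theorem mainTheorem3:
  shows "ereal 0.171028 \<le> kazhdan_constant TYPE('h) St3 St3_gens"
  unfolding kazhdan_constant_def
proof (rule Inf_greatest, clarify)
  fix H :: "'h inner_module" and \<pi>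
  assume rep: "unitary_rep St3 H \<pi>" and ninv: "no_invariant_vectors St3 H \<pi>"
  interpret St3_rep H \<pi> using rep by (simp add: St3_rep_def)
  have "finite St3_gens"
    by (simp add: St3_gens_def St3_indices_eq_roots)
  then have "ereal 0.171028 \<le> Max ((\<lambda>s. ereal (hnorm H (\<pi> s \<xi> \<ominus>\<^bsub>H\<^esub> \<xi>))) ` St3_gens)"
    if "\<xi> \<in> carrier H" "hnorm H \<xi> = 1" for \<xi>
    using exists_gen_displacing[OF ninv that] by (subst Max_ge_iff) auto
  then show "ereal 0.171028 \<le> rep_kazhdan_constant St3_gens H \<pi>"
    unfolding rep_kazhdan_constant_def by (intro INF_greatest) auto
qed

end
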